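(* Let $n\geq 1$ and let $\|\cdot\|$ be a Euclidean norm on $\mathrm{LT}^0(n)$. The Riemannian operations of the Euclidean-Cholesky metric on $\mathrm{Cor}^+(n)$ associated to this norm are, for all $C,C',C_1,\dots,C_k\in\mathrm{Cor}^+(n)$ ($k\geq1$), $X\in T_C\mathrm{Cor}^+(n)\simeq\mathrm{Hol}(n)$, $t\in\mathbb{R}$: - (Exponential map) $\mathrm{Exp}_C(tX)=\Theta^{-1}(\Theta(C)+t\,d_C\Theta(X))$; - (Logarithm map) $\mathrm{Log}_C(C')=(d_C\Theta)^{-1}(\Theta(C')-\Theta(C))$; - (Geodesic from $C$ at $t=0$ to $C'$ at $t=1$) $\gamma_{C\to C'}(t)=\Theta^{-1}((1-t)\Theta(C)+t\,\Theta(C'))$; - (Distance) $d(C,C')=\|\Theta(C')-\Theta(C)\|$; - (Parallel transport) $\Pi_{C\to C'}X=(d_{C'}\Theta)^{-1}(d_C\Theta(X))$; - (Curvature) null; - (Fréchet mean of $C_1,\dots,C_k$) $\bar C=\Theta^{-1}\big(\frac1k\sum_{i=1}^k\Theta(C_i)\big)$; where $d_C\Theta(X)=\Theta(C)\,\mathrm{low}_{\mathrm{S}}(L^{-1}XL^{-\top})-\frac12\mathrm{Diag}(L^{-1}XL^{-\top})\,\Theta(C)$ and $L=\mathrm{Chol}(C)$. The Euclidean-Cholesky metrics are geodesically complete.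
   Context: $\mathrm{Cor}^+(n)$ is the manifold of real symmetric positive definite $n\times n$ matrices with unit diagonal; $\mathrm{Hol}(n)$ is the space of symmetric matrices with zero diagonal. $\mathrm{LT}^0(n)$ is the vector space of strictly lower triangular matrices and $\mathrm{LT}^1(n)=I_n+\mathrm{LT}^0(n)$ the lower triangular matrices with unit diagonal. $\mathrm{Diag}(M)$ is the diagonal matrix with the same diagonal as $M$. $\mathrm{Chol}(C)$ is the unique lower triangular matrix $L$ with positive diagonal such that $C=LL^\top$. For symmetric $M$, $\mathrm{low}_{\mathrm{S}}(M)$ is the strictly lower triangular part of $M$ plus $\frac12\mathrm{Diag}(M)$. The map $\Theta:\mathrm{Cor}^+(n)\to\mathrm{LT}^1(n)$, $\Theta(C)=\mathrm{Diag}(\mathrm{Chol}(C))^{-1}\mathrm{Chol}(C)$, is a diffeomorphism with inverse $\Gamma\mapsto\mathrm{Diag}(\Gamma\Gamma^\top)^{-1/2}\,\Gamma\Gamma^\top\,\mathrm{Diag}(\Gamma\Gamma^\top)^{-1/2}$; $d_C\Theta:\mathrm{Hol}(n)\to\mathrm{LT}^0(n)$ is its differential. The Euclidean-Cholesky metric associated to a Euclidean norm $\|\cdot\|$ on $\mathrm{LT}^0(n)$ (norm coming from an inner product) is the pullback by $\Theta$ of the constant Riemannian metric on the affine space $\mathrm{LT}^1(n)$ given by that inner product, i.e. $g_C(X,X)=\|d_C\Theta(X)\|^2$. A Fréchet mean of $C_1,\dots,C_k$ is a minimizer of $C\mapsto\sum_{i=1}^kd(C,C_i)^2$; it is unique here.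 *)

theory Defs
  imports "HOL-Analysis.Analysis"
begin

section \<open>Riemannian geometry on a relatively open subset of an affine space\<close>

text \<open>
  Throughout this section \<open>M\<close> is meant to be a relatively open subset of an affine
  space with direction the linear subspace \<open>V\<close>, so that every tangent space of \<open>M\<close> is \<open>V\<close>,
  and \<open>g p\<close> is the inner product on \<open>V\<close> at the point \<open>p\<close>.  Derivatives are taken
  \<open>at p within M\<close>.  Such a derivative is unique as a linear map on \<open>V\<close> (though not on the
  whole ambient space), and it is only ever applied to elements of \<open>V\<close>.
\<close>

definition inner_product_on :: "'a::real_vector set \<Rightarrow> ('a \<Rightarrow> 'a \<Rightarrow> real) \<Rightarrow> bool" where
  "inner_product_on V ip \<longleftrightarrow>
     (\<forall>x\<in>V. \<forall>y\<in>V. \<forall>z\<in>V. ip (x + y) z = ip x z + ip y z) \<and>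
     (\<forall>c. \<forall>x\<in>V. \<forall>y\<in>V. ip (c *\<^sub>R x) y = c * ip x y) \<and>
     (\<forall>x\<in>V. \<forall>y\<in>V. ip x y = ip y x) \<and>
     (\<forall>x\<in>V. x \<noteq> 0 \<longrightarrow> ip x x > 0)"

primrec Ck_on ::
  "'a::real_normed_vector set \<Rightarrow> 'a set \<Rightarrow> nat \<Rightarrow> ('a \<Rightarrow> 'b::real_normed_vector) \<Rightarrow> bool" where
  "Ck_on M V 0 f \<longleftrightarrow> continuous_on M f"
| "Ck_on M V (Suc k) f \<longleftrightarrow>
     f differentiable_on M \<and>
     (\<forall>X\<in>V. Ck_on M V k (\<lambda>p. frechet_derivative f (at p within M) X))"

definition smooth_fun_on ::
  "'a::real_normed_vector set \<Rightarrow> 'a set \<Rightarrow> ('a \<Rightarrow> 'b::real_normed_vector) \<Rightarrow> bool" where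
  "smooth_fun_on M V f \<longleftrightarrow> (\<forall>k. Ck_on M V k f)"

definition riemannian_metric_on ::
  "'a::real_normed_vector set \<Rightarrow> 'a set \<Rightarrow> ('a \<Rightarrow> 'a \<Rightarrow> 'a \<Rightarrow> real) \<Rightarrow> bool" where
  "riemannian_metric_on M V g \<longleftrightarrow>
     (\<forall>p\<in>M. inner_product_on V (g p)) \<and>
     (\<forall>X\<in>V. \<forall>Y\<in>V. smooth_fun_on M V (\<lambda>p. g p X Y))"

text \<open>
  A connection is represented by its Christoffel map \<open>\<Gamma>\<close> in the affine coordinates:
  \<open>\<nabla>\<^sub>X Y = D Y(X) + \<Gamma> p X Y\<close>.  For constant vector fields \<open>X\<close>, \<open>Y\<close>, \<open>Z\<close> torsion-freeness
  reads \<open>\<Gamma> p X Y = \<Gamma> p Y X\<close>, and compatibility with the metric reads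
  \<open>X(g(Y,Z)) = g(\<nabla>\<^sub>X Y, Z) + g(Y, \<nabla>\<^sub>X Z)\<close>.
\<close>

definition levi_civita ::
  "'a::real_normed_vector set \<Rightarrow> 'a set \<Rightarrow> ('a \<Rightarrow> 'a \<Rightarrow> 'a \<Rightarrow> real) \<Rightarrow> ('a \<Rightarrow> 'a \<Rightarrow> 'a \<Rightarrow> 'a) \<Rightarrow> bool"
  where
  "levi_civita M V g \<Gamma> \<longleftrightarrow> (\<forall>p\<in>M.
     (\<forall>X\<in>V. \<forall>Y\<in>V. \<Gamma> p X Y \<in> V) \<and>
     (\<forall>X\<in>V. \<forall>Y\<in>V. \<forall>Z\<in>V. \<Gamma> p (X + Y) Z = \<Gamma> p X Z + \<Gamma> p Y Z) \<and>
     (\<forall>c. \<forall>X\<in>V. \<forall>Y\<in>V. \<Gamma> p (c *\<^sub>R X) Y = c *\<^sub>R \<Gamma> p X Y) \<and>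
     (\<forall>X\<in>V. \<forall>Y\<in>V. \<Gamma> p X Y = \<Gamma> p Y X) \<and>
     (\<forall>X\<in>V. \<forall>Y\<in>V. \<forall>Z\<in>V.
        frechet_derivative (\<lambda>q. g q Y Z) (at p within M) X = g p (\<Gamma> p X Y) Z + g p Y (\<Gamma> p X Z)))"

text \<open>By the fundamental theorem of Riemannian geometry the choice is unique on \<open>M\<close> and \<open>V\<close>.\<close>

definition christoffel ::
  "'a::real_normed_vector set \<Rightarrow> 'a set \<Rightarrow> ('a \<Rightarrow> 'a \<Rightarrow> 'a \<Rightarrow> real) \<Rightarrow> 'a \<Rightarrow> 'a \<Rightarrow> 'a \<Rightarrow> 'a" where
  "christoffel M V g = (SOME \<Gamma>. levi_civita M V g \<Gamma>)"

text \<open>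
  The geodesic equation \<open>\<gamma>'' + \<Gamma>(\<gamma>', \<gamma>') = 0\<close> on the interval \<open>I\<close>, with \<open>v\<close> the velocity of \<open>\<gamma>\<close>.
\<close>

definition geodesic_on ::
  "'a::real_normed_vector set \<Rightarrow> 'a set \<Rightarrow> ('a \<Rightarrow> 'a \<Rightarrow> 'a \<Rightarrow> real) \<Rightarrow> real set \<Rightarrow> (real \<Rightarrow> 'a) \<Rightarrow> bool"
  where
  "geodesic_on M V g I \<gamma> \<longleftrightarrow> (\<exists>v. \<forall>t\<in>I. \<gamma> t \<in> M \<and>
     (\<gamma> has_vector_derivative v t) (at t within I) \<and>
     (v has_vector_derivative - christoffel M V g (\<gamma> t) (v t) (v t)) (at t within I))"

definition riem_exp ::
  "'a::real_normed_vector set \<Rightarrow> 'a set \<Rightarrow> ('a \<Rightarrow> 'a \<Rightarrow> 'a \<Rightarrow> real) \<Rightarrow> 'a \<Rightarrow> 'a \<Rightarrow> 'a" where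
  "riem_exp M V g p X = (THE q. \<exists>\<gamma>. geodesic_on M V g {0..1} \<gamma> \<and> \<gamma> 0 = p \<and>
     (\<gamma> has_vector_derivative X) (at 0 within {0..1}) \<and> \<gamma> 1 = q)"

text \<open>
  The logarithm is the inverse of the exponential map on the whole tangent space; this is the
  right notion when \<open>Exp\<^sub>p\<close> is a bijection from \<open>V\<close> onto \<open>M\<close> (empty cut locus).
\<close>

definition riem_log ::
  "'a::real_normed_vector set \<Rightarrow> 'a set \<Rightarrow> ('a \<Rightarrow> 'a \<Rightarrow> 'a \<Rightarrow> real) \<Rightarrow> 'a \<Rightarrow> 'a \<Rightarrow> 'a" where
  "riem_log M V g p = inv_into V (riem_exp M V g p)"

definition geodesically_complete ::
  "'a::real_normed_vector set \<Rightarrow> 'a set \<Rightarrow> ('a \<Rightarrow> 'a \<Rightarrow> 'a \<Rightarrow> real) \<Rightarrow> bool" where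
  "geodesically_complete M V g \<longleftrightarrow> (\<forall>p\<in>M. \<forall>X\<in>V. \<exists>\<gamma>. geodesic_on M V g UNIV \<gamma> \<and> \<gamma> 0 = p \<and>
     (\<gamma> has_vector_derivative X) (at 0))"

definition curve_speed ::
  "('a::real_normed_vector \<Rightarrow> 'a \<Rightarrow> 'a \<Rightarrow> real) \<Rightarrow> (real \<Rightarrow> 'a) \<Rightarrow> real \<Rightarrow> real" where
  "curve_speed g \<gamma> t =
     sqrt (g (\<gamma> t) (vector_derivative \<gamma> (at t)) (vector_derivative \<gamma> (at t)))"

text \<open>
  The derivative of a \<open>piecewise_C1_differentiable_on\<close> curve may blow up at the finitely many
  exceptional points, where the curve could have infinite length; \<open>integral\<close> would then
  be \<open>0\<close>.  The integrability condition rules this out.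
\<close>

definition riem_dist ::
  "'a::real_normed_vector set \<Rightarrow> ('a \<Rightarrow> 'a \<Rightarrow> 'a \<Rightarrow> real) \<Rightarrow> 'a \<Rightarrow> 'a \<Rightarrow> real" where
  "riem_dist M g p q = Inf {integral {0..1} (curve_speed g \<gamma>) | \<gamma>.
     \<gamma> piecewise_C1_differentiable_on {0..1} \<and> \<gamma> ` {0..1} \<subseteq> M \<and> \<gamma> 0 = p \<and> \<gamma> 1 = q \<and>
     curve_speed g \<gamma> integrable_on {0..1}}"

definition parallel_along ::
  "'a::real_normed_vector set \<Rightarrow> 'a set \<Rightarrow> ('a \<Rightarrow> 'a \<Rightarrow> 'a \<Rightarrow> real) \<Rightarrow> real set \<Rightarrow>
   (real \<Rightarrow> 'a) \<Rightarrow> (real \<Rightarrow> 'a) \<Rightarrow> bool" where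
  "parallel_along M V g I \<gamma> W \<longleftrightarrow> (\<forall>t\<in>I. W t \<in> V \<and>
     (W has_vector_derivative
        - christoffel M V g (\<gamma> t) (vector_derivative \<gamma> (at t within I)) (W t)) (at t within I))"

text \<open>Parallel transport from \<open>p\<close> to \<open>q\<close> is along the geodesic joining \<open>p\<close> to \<open>q\<close>.\<close>

definition riem_transport ::
  "'a::real_normed_vector set \<Rightarrow> 'a set \<Rightarrow> ('a \<Rightarrow> 'a \<Rightarrow> 'a \<Rightarrow> real) \<Rightarrow> 'a \<Rightarrow> 'a \<Rightarrow> 'a \<Rightarrow> 'a" where
  "riem_transport M V g p q X = (THE Y. \<exists>\<gamma> W.
     geodesic_on M V g {0..1} \<gamma> \<and> \<gamma> 0 = p \<and> \<gamma> 1 = q \<and>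
     parallel_along M V g {0..1} \<gamma> W \<and> W 0 = X \<and> W 1 = Y)"

text \<open>
  \<open>R(X,Y)Z = \<nabla>\<^sub>X \<nabla>\<^sub>Y Z - \<nabla>\<^sub>Y \<nabla>\<^sub>X Z - \<nabla>\<^sub>[\<^sub>X\<^sub>,\<^sub>Y\<^sub>] Z\<close> evaluated on constant vector fields
  (for which \<open>[X,Y] = 0\<close>).
\<close>

definition riem_curvature ::
  "'a::real_normed_vector set \<Rightarrow> 'a set \<Rightarrow> ('a \<Rightarrow> 'a \<Rightarrow> 'a \<Rightarrow> real) \<Rightarrow> 'a \<Rightarrow> 'a \<Rightarrow> 'a \<Rightarrow> 'a \<Rightarrow> 'a" where
  "riem_curvature M V g p X Y Z = (let \<Gamma> = christoffel M V g in
     frechet_derivative (\<lambda>q. \<Gamma> q Y Z) (at p within M) X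
     - frechet_derivative (\<lambda>q. \<Gamma> q X Z) (at p within M) Y
     + \<Gamma> p X (\<Gamma> p Y Z) - \<Gamma> p Y (\<Gamma> p X Z))"

definition is_frechet_mean ::
  "'a set \<Rightarrow> ('a \<Rightarrow> 'a \<Rightarrow> real) \<Rightarrow> nat \<Rightarrow> (nat \<Rightarrow> 'a) \<Rightarrow> 'a \<Rightarrow> bool" where
  "is_frechet_mean M d k Cs p \<longleftrightarrow> is_arg_min (\<lambda>q. \<Sum>i=1..k. (d q (Cs i))\<^sup>2) (\<lambda>q. q \<in> M) p"

section \<open>Correlation matrices and Euclidean-Cholesky metrics\<close>

type_synonym 'n sqmat = "((real, 'n) vec, 'n) vec"

definition cor_pos :: "('n::finite) sqmat set" where
  "cor_pos = {C. transpose C = C \<and> (\<forall>x. x \<noteq> 0 \<longrightarrow> x \<bullet> (C *v x) > 0) \<and> (\<forall>i. C $ i $ i = 1)}"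

definition hol :: "('n::finite) sqmat set" where
  "hol = {X. transpose X = X \<and> (\<forall>i. X $ i $ i = 0)}"

definition lower_tri :: "('n::{finite,linorder}) sqmat \<Rightarrow> bool" where
  "lower_tri M \<longleftrightarrow> (\<forall>i j. i < j \<longrightarrow> M $ i $ j = 0)"

definition LT0 :: "('n::{finite,linorder}) sqmat set" where
  "LT0 = {M. lower_tri M \<and> (\<forall>i. M $ i $ i = 0)}"

definition diag_of :: "('n::finite) sqmat \<Rightarrow> 'n sqmat" where
  "diag_of M = (\<chi> i j. if i = j then M $ i $ j else 0)"

definition lowS :: "('n::{finite,linorder}) sqmat \<Rightarrow> 'n sqmat" where
  "lowS M = (\<chi> i j. if j < i then M $ i $ j else if i = j then M $ i $ j / 2 else 0)"

definition chol :: "('n::{finite,linorder}) sqmat \<Rightarrow> 'n sqmat" where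
  "chol C = (THE L. lower_tri L \<and> (\<forall>i. L $ i $ i > 0) \<and> C = L ** transpose L)"

definition Theta :: "('n::{finite,linorder}) sqmat \<Rightarrow> 'n sqmat" where
  "Theta C = matrix_inv (diag_of (chol C)) ** chol C"

definition Theta_inv :: "('n::{finite,linorder}) sqmat \<Rightarrow> 'n sqmat" where
  "Theta_inv = inv_into cor_pos Theta"

text \<open>The differential of \<open>Theta\<close> at \<open>C\<close>; only its values on the tangent space \<open>hol\<close> are determined.\<close>

definition dTheta :: "('n::{finite,linorder}) sqmat \<Rightarrow> 'n sqmat \<Rightarrow> 'n sqmat" where
  "dTheta C = frechet_derivative Theta (at C within cor_pos)"

definition dTheta_inv :: "('n::{finite,linorder}) sqmat \<Rightarrow> 'n sqmat \<Rightarrow> 'n sqmat" where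
  "dTheta_inv C = inv_into hol (dTheta C)"

definition ec_metric :: "(('n::{finite,linorder}) sqmat \<Rightarrow> 'n sqmat \<Rightarrow> real) \<Rightarrow>
    'n sqmat \<Rightarrow> 'n sqmat \<Rightarrow> 'n sqmat \<Rightarrow> real" where
  "ec_metric ip C X Y = ip (dTheta C X) (dTheta C Y)"

end

theory Submission
  imports Defs
begin

text \<open>
  The map \<open>Theta\<close> is a global diffeomorphism onto an affine space that carries the metric to a constant
  one. In any such chart \<open>T\<close> with inverse \<open>F\<close> the Levi-Civita connection is
  \<open>\<Gamma>(X, Y) = DF (D\<^sup>2T(X, Y))\<close>, so that \<open>D/dt (DT(W)) = DT(\<nabla>W/dt)\<close> along every curve. Hence parallel
  fields are those with constant image under \<open>DT\<close>, geodesics are the preimages of affine lines, the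
  curvature vanishes by symmetry of the second derivatives of \<open>T\<close> and of \<open>DT(Z)\<close>, and distances and
  Frechet means are those of a Euclidean space. What remains is that \<open>Theta\<close> is such a chart, which is
  read off the column-by-column recursion for the Cholesky factor.
\<close>

section \<open>Calculus on relatively open subsets of affine spaces\<close>

text \<open>\<open>cor_pos\<close> has empty interior in the space of all matrices, so a derivative
  within it is determined on tangent directions only, and the choice made by
  \<open>christoffel\<close> is determined only there as well. This shapes the calculus:
  differentials are compared by evaluating them on tangent vectors, and an equation is pulled back
  through \<open>dT\<close> only after both sides are known to lie in \<open>V\<close>. The product
  rule feels the same restriction, because \<open>dT q\<close> is known to be differentiable in
  \<open>q\<close> only when applied to a fixed vector of \<open>V\<close>. The formula for the
  connection comes from the Leibniz rule: since \<open>ip\<close> is constant, differentiating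
  \<open>ip (DT Y) (DT Z)\<close> produces second derivatives of \<open>T\<close>, and compatibility
  asks that \<open>DT\<close> carry the connection to them.\<close>

lemma has_derivative_within_cong:
  assumes "x \<in> S" "\<And>y. y \<in> S \<Longrightarrow> f y = h y"
  shows "(f has_derivative D) (at x within S) \<longleftrightarrow> (h has_derivative D) (at x within S)"
  using assms has_derivative_transform[of x S f h] has_derivative_transform[of x S h f] by auto

lemma has_vector_derivative_compose_within:
  assumes "(f has_derivative f') (at (\<gamma> t) within M)" and "\<gamma> ` I \<subseteq> M"
    and "(\<gamma> has_vector_derivative v) (at t within I)"
  shows "((\<lambda>s. f (\<gamma> s)) has_vector_derivative f' v) (at t within I)"
proof -
  interpret bounded_linear f'
    using assms(1) by (rule has_derivative_bounded_linear)
  have "((\<lambda>s. f (\<gamma> s)) has_derivative (\<lambda>h. f' (h *\<^sub>R v))) (at t within I)"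
    using has_derivative_in_compose[OF assms(3)[unfolded has_vector_derivative_def]
        has_derivative_subset[OF assms(1,2)]] .
  then show ?thesis
    by (simp add: has_vector_derivative_def scaleR)
qed

lemma subspace_orthonormal_expansion:
  fixes V :: "'a::euclidean_space set"
  assumes "subspace V"
  obtains B where "finite B" "B \<subseteq> V" "\<And>x. x \<in> V \<Longrightarrow> (\<Sum>b\<in>B. (x \<bullet> b) *\<^sub>R b) = x"
proof -
  obtain B where B: "B \<subseteq> V" "pairwise orthogonal B" "\<And>x. x \<in> B \<Longrightarrow> norm x = 1"
      "independent B" "span B = V"
    using orthonormal_basis_subspace[OF assms] by metis
  moreover have "finite B"
    using B(4) by (rule independent_imp_finite)
  ultimately show ?thesis
    by (intro that) (auto intro: orthonormal_basis_expand)
qed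

text \<open>Composition with a bounded projection turns statements about values in \<open>V\<close>
  into statements about bounded linear maps of the whole space.\<close>

lemma subspace_projection:
  fixes V :: "'a::euclidean_space set"
  assumes "subspace V"
  obtains P where "bounded_linear P" "\<And>x. P x \<in> V" "\<And>x. x \<in> V \<Longrightarrow> P x = x"
proof -
  obtain B where B: "finite B" "B \<subseteq> V" "\<And>x. x \<in> V \<Longrightarrow> (\<Sum>b\<in>B. (x \<bullet> b) *\<^sub>R b) = x"
    using subspace_orthonormal_expansion[OF assms] by blast
  show ?thesis
  proof (rule that)
    show "bounded_linear (\<lambda>x. \<Sum>b\<in>B. (x \<bullet> b) *\<^sub>R b)"
      by (intro bounded_linear_sum bounded_linear_scaleR_const bounded_linear_inner_left)
    show "(\<Sum>b\<in>B. (x \<bullet> b) *\<^sub>R b) \<in> V" for x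
      using B(2) by (intro subspace_sum subspace_scale assms) auto
  qed (rule B(3))
qed

text \<open>A curve whose increments lie in \<open>V\<close> coincides with its projection to
  \<open>V\<close>, so its velocity is fixed by the projection.\<close>

lemma has_vector_derivative_mem_subspace:
  fixes V :: "'a::euclidean_space set"
  assumes "(\<gamma> has_vector_derivative v) (at t within I)" and "at t within I \<noteq> bot"
    and "subspace V" and "t \<in> I" "\<And>s. s \<in> I \<Longrightarrow> \<gamma> s - \<gamma> t \<in> V"
  shows "v \<in> V"
proof -
  obtain P where P: "bounded_linear P" "\<And>x. P x \<in> V" "\<And>x. x \<in> V \<Longrightarrow> P x = x"
    using subspace_projection[OF assms(3)] by blast
  have "((\<lambda>s. \<gamma> s - \<gamma> t) has_vector_derivative v - 0) (at t within I)"
    by (intro has_vector_derivative_diff assms has_vector_derivative_const)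
  then have v: "((\<lambda>s. \<gamma> s - \<gamma> t) has_vector_derivative v) (at t within I)"
    by simp
  have "((\<lambda>s. P (\<gamma> s - \<gamma> t)) has_vector_derivative P v) (at t within I)"
    by (rule bounded_linear.has_vector_derivative[OF P(1) v])
  then have "((\<lambda>s. \<gamma> s - \<gamma> t) has_vector_derivative P v) (at t within I)"
    by (rule has_vector_derivative_transform[rotated 2]) (simp_all add: assms(4,5) P(3))
  then have "v = P v"
    using vector_derivative_unique_within[OF assms(2) v] by blast
  then show ?thesis
    using P(2) by metis
qed

text \<open>Product rule for linear maps of which only the values at fixed vectors of
  \<open>V\<close> are known to be differentiable. Expanding the moving argument in a basis of
  \<open>V\<close> reduces it to finitely many such values.\<close>

lemma has_derivative_linear_family:
  fixes A :: "'a::real_normed_vector \<Rightarrow> 'b::euclidean_space \<Rightarrow> 'c::real_normed_vector"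
  assumes "subspace V" and lin: "\<And>s. s \<in> S \<Longrightarrow> linear (A s)"
    and A': "\<And>w. w \<in> V \<Longrightarrow> ((\<lambda>s. A s w) has_derivative A' w) (at x within S)"
    and w: "(w has_derivative w') (at x within S)" "\<And>s. s \<in> S \<Longrightarrow> w s \<in> V" and "x \<in> S"
    and bl: "bounded_linear (A x)"
  shows "((\<lambda>s. A s (w s)) has_derivative (\<lambda>k. A' (w x) k + A x (w' k))) (at x within S)"
proof -
  obtain B where B: "finite B" "B \<subseteq> V" "\<And>x. x \<in> V \<Longrightarrow> (\<Sum>b\<in>B. (x \<bullet> b) *\<^sub>R b) = x"
    using subspace_orthonormal_expansion[OF assms(1)] by blast
  \<comment> \<open>The mixed increment: each summand is a product of two factors that both vanish
    at \<open>x\<close>, so its derivative there is zero.\<close>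
  define R where "R = (\<lambda>s. \<Sum>b\<in>B. ((w s - w x) \<bullet> b) *\<^sub>R (A s b - A x b))"
  have "((\<lambda>s. ((w s - w x) \<bullet> b) *\<^sub>R (A s b - A x b)) has_derivative (\<lambda>k. 0)) (at x within S)"
    if "b \<in> B" for b
    using B(2) that by (auto intro!: derivative_eq_intros w(1) A')
  from has_derivative_sum[OF this, of B "\<lambda>b. b"] have R: "(R has_derivative (\<lambda>k. 0)) (at x within S)"
    unfolding R_def by simp
  have "((\<lambda>s. A s (w x) + A x (w s - w x) + R s)
      has_derivative (\<lambda>k. A' (w x) k + A x (w' k - 0) + 0)) (at x within S)"
    by (intro has_derivative_add R A' w assms(6) bounded_linear.has_derivative[OF bl]
        has_derivative_diff has_derivative_const)
  moreover have "A s (w s) = A s (w x) + A x (w s - w x) + R s" if "s \<in> S" for s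
  proof -
    have V: "w s - w x \<in> V"
      using assms(1) w(2) \<open>x \<in> S\<close> that by (auto intro: subspace_diff)
    have "A r (w s - w x) = (\<Sum>b\<in>B. ((w s - w x) \<bullet> b) *\<^sub>R A r b)" if "r \<in> S" for r
      by (subst B(3)[OF V, symmetric]) (simp add: linear_sum[OF lin[OF that]] linear_scale[OF lin[OF that]])
    from this[OF that] this[OF \<open>x \<in> S\<close>] have "R s = A s (w s - w x) - A x (w s - w x)"
      by (simp add: R_def scaleR_diff_right sum_subtractf)
    then show ?thesis
      by (simp add: linear_diff[OF lin[OF that]])
  qed
  ultimately show ?thesis
    using has_derivative_transform[OF \<open>x \<in> S\<close>, of "\<lambda>s. A s (w s)" "\<lambda>s. A s (w x) + A x (w s - w x) + R s"] by simp
qed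

text \<open>Relative openness is expressed by small steps along \<open>V\<close>, which avoids
  naming the ambient affine space.\<close>

locale open_in_affine =
  fixes M V :: "'a::euclidean_space set"
  assumes subspace: "subspace V"
    and diff_mem: "p \<in> M \<Longrightarrow> q \<in> M \<Longrightarrow> q - p \<in> V"
    and rel_open: "p \<in> M \<Longrightarrow> \<exists>e>0. \<forall>X\<in>V. norm X < e \<longrightarrow> p + X \<in> M"
begin

text \<open>Moving along a segment inside \<open>M\<close> turns a derivative within
  \<open>M\<close> into a two-sided derivative in one real variable; this is what makes derivatives
  unique on \<open>V\<close>.\<close>

lemma has_vector_derivative_line:
  assumes "p \<in> M" "X \<in> V" "(f has_derivative f') (at p within M)"
  shows "((\<lambda>t. f (p + t *\<^sub>R X)) has_vector_derivative f' X) (at 0)"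
proof -
  obtain e where e: "e > 0" "\<And>X. X \<in> V \<Longrightarrow> norm X < e \<Longrightarrow> p + X \<in> M"
    using rel_open[OF assms(1)] by auto
  \<comment> \<open>The summand 1 keeps the quotient meaningful when \<open>X = 0\<close> and still
    forces \<open>norm (t *\<^sub>R X) < e\<close>.\<close>
  define I :: "real set" where "I = ball 0 (e / (norm X + 1))"
  have I: "open I" "0 \<in> I"
    using e(1) by (auto simp: I_def add_nonneg_pos)
  have "p + t *\<^sub>R X \<in> M" if "t \<in> I" for t :: real
  proof (intro e subspace_scale[OF subspace] assms)
    have "\<bar>t\<bar> * (norm X + 1) < e"
      using that by (simp add: I_def pos_less_divide_eq add_nonneg_pos)
    then show "norm (t *\<^sub>R X) < e"
      by (simp add: distrib_left)
  qed
  then have "(\<lambda>t. p + t *\<^sub>R X) ` I \<subseteq> M"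
    by auto
  moreover have "((\<lambda>t. p + t *\<^sub>R X) has_vector_derivative X) (at 0 within I)"
    by (auto intro!: derivative_eq_intros)
  ultimately have "((\<lambda>t. f (p + t *\<^sub>R X)) has_vector_derivative f' X) (at 0 within I)"
    by (rule has_vector_derivative_compose_within[where M = M, rotated]) (simp_all add: assms(3))
  then show ?thesis
    unfolding at_within_open[OF I(2,1)] .
qed

lemma has_derivative_unique_on:
  assumes "p \<in> M" "X \<in> V" "(f has_derivative f1) (at p within M)" "(f has_derivative f2) (at p within M)"
  shows "f1 X = f2 X"
  using vector_derivative_unique_at[OF has_vector_derivative_line[OF assms(1,2,3)]
      has_vector_derivative_line[OF assms(1,2,4)]] .

lemma frechet_derivative_eq:
  assumes "p \<in> M" "X \<in> V" "(f has_derivative f') (at p within M)"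
  shows "frechet_derivative f (at p within M) X = f' X"
proof -
  have "(f has_derivative frechet_derivative f (at p within M)) (at p within M)"
    using assms(3) frechet_derivative_works unfolding differentiable_def by blast
  then show ?thesis
    using has_derivative_unique_on assms by blast
qed

lemma has_derivative_mem_subspace:
  fixes U :: "'b::euclidean_space set"
  assumes "p \<in> M" "X \<in> V" "(f has_derivative f') (at p within M)"
    and "subspace U" "\<And>q. q \<in> M \<Longrightarrow> f q - f p \<in> U"
  shows "f' X \<in> U"
proof -
  obtain P where P: "bounded_linear P" "\<And>x. P x \<in> U" "\<And>x. x \<in> U \<Longrightarrow> P x = x"
    using subspace_projection[OF assms(4)] by blast
  have *: "((\<lambda>q. f q - f p) has_derivative (\<lambda>h. f' h - 0)) (at p within M)"
    by (intro has_derivative_diff assms has_derivative_const)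
  have "((\<lambda>q. P (f q - f p)) has_derivative (\<lambda>h. P (f' h - 0))) (at p within M)"
    by (rule bounded_linear.has_derivative[OF P(1) *])
  then have "((\<lambda>q. f q - f p) has_derivative (\<lambda>h. P (f' h - 0))) (at p within M)"
    by (rule has_derivative_transform[rotated 2]) (simp_all add: assms(1,5) P(3))
  from has_derivative_unique_on[OF assms(1,2) * this] show ?thesis
    using P(2) by (metis diff_zero)
qed

section \<open>Closure properties of smooth functions\<close>

lemma Ck_on_cong:
  assumes "\<And>p. p \<in> M \<Longrightarrow> f p = h p"
  shows "Ck_on M V k f \<longleftrightarrow> Ck_on M V k h"
  using assms
proof (induction k arbitrary: f h)
  case 0
  then show ?case by (simp cong: continuous_on_cong)
next
  case (Suc k)
  have "(f has_derivative D) (at p within M) \<longleftrightarrow> (h has_derivative D) (at p within M)" if "p \<in> M" for p D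
    using Suc.prems that by (intro has_derivative_within_cong) auto
  then have "f differentiable_on M \<longleftrightarrow> h differentiable_on M"
    and "\<And>p. p \<in> M \<Longrightarrow> frechet_derivative f (at p within M) = frechet_derivative h (at p within M)"
    by (auto simp: differentiable_on_def differentiable_def frechet_derivative_def)
  moreover from this(2) have "Ck_on M V k (\<lambda>p. frechet_derivative f (at p within M) X) \<longleftrightarrow>
      Ck_on M V k (\<lambda>p. frechet_derivative h (at p within M) X)" for X
    by (intro Suc.IH) simp
  ultimately show ?case by simp
qed

text \<open>\<open>Ck_on\<close> looks at \<open>frechet_derivative\<close> only on
  \<open>V\<close>, where it is unique, so any explicit derivative may stand in for it.\<close>

lemma Ck_on_SucI:
  assumes "\<And>p. p \<in> M \<Longrightarrow> (f has_derivative f' p) (at p within M)"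
    and "\<And>X. X \<in> V \<Longrightarrow> Ck_on M V k (\<lambda>p. f' p X)"
  shows "Ck_on M V (Suc k) f"
proof -
  have "Ck_on M V k (\<lambda>p. frechet_derivative f (at p within M) X)" if "X \<in> V" for X
    using assms(2)[OF that] assms(1) that
    by (subst Ck_on_cong[where h = "\<lambda>p. f' p X"]) (auto simp: frechet_derivative_eq)
  then show ?thesis
    using assms(1) by (auto simp: differentiable_on_def differentiable_def)
qed

lemma Ck_on_Suc_has_derivative:
  assumes "Ck_on M V (Suc k) f" "p \<in> M"
  shows "(f has_derivative frechet_derivative f (at p within M)) (at p within M)"
  using assms by (auto simp: differentiable_on_def frechet_derivative_works)

lemma Ck_on_Suc_imp: "Ck_on M V (Suc k) f \<Longrightarrow> Ck_on M V k f"
proof (induction k arbitrary: f)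
  case 0
  then show ?case by (simp add: differentiable_imp_continuous_on)
next
  case (Suc k)
  then show ?case
    by (metis Ck_on.simps(2))
qed

lemma Ck_on_const: "Ck_on M V k (\<lambda>p. c)"
  by (induction k arbitrary: c) (auto simp del: Ck_on.simps(2) intro: Ck_on_SucI[OF has_derivative_const])

lemma Ck_on_linear:
  assumes "bounded_linear L" and "Ck_on M V k f"
  shows "Ck_on M V k (\<lambda>p. L (f p))"
  using assms(2)
proof (induction k arbitrary: f)
  case 0
  then show ?case
    using assms(1) by (simp add: bounded_linear.continuous_on)
next
  case (Suc k)
  show ?case
    by (rule Ck_on_SucI[OF bounded_linear.has_derivative[OF assms(1) Ck_on_Suc_has_derivative[OF Suc.prems]]])
      (use Suc in auto)
qed

lemma Ck_on_add:
  assumes "Ck_on M V k f" "Ck_on M V k h"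
  shows "Ck_on M V k (\<lambda>p. f p + h p)"
  using assms
proof (induction k arbitrary: f h)
  case 0
  then show ?case by (simp add: continuous_on_add)
next
  case (Suc k)
  show ?case
    by (rule Ck_on_SucI[OF has_derivative_add[OF Ck_on_Suc_has_derivative[OF Suc.prems(1)]
          Ck_on_Suc_has_derivative[OF Suc.prems(2)]]]) (use Suc in auto)
qed

lemma Ck_on_bilinear:
  assumes "bounded_bilinear b" and "Ck_on M V k f" "Ck_on M V k h"
  shows "Ck_on M V k (\<lambda>p. b (f p) (h p))"
  using assms(2,3)
proof (induction k arbitrary: f h)
  case 0
  then show ?case
    using assms(1) by (simp add: bounded_bilinear.continuous_on)
next
  case (Suc k)
  note fh = Suc.prems[THEN Ck_on_Suc_imp] and D = Suc.prems[THEN Ck_on_Suc_has_derivative]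
  have "Ck_on M V k (\<lambda>p. b (f p) (frechet_derivative h (at p within M) X)
      + b (frechet_derivative f (at p within M) X) (h p))" if "X \<in> V" for X
    using Suc.prems that by (intro Ck_on_add[OF Suc.IH Suc.IH] fh) auto
  then show ?case
    by (intro Ck_on_SucI[OF bounded_bilinear.FDERIV[OF assms(1) D]])
qed

lemmas Ck_on_mult = Ck_on_bilinear[OF bounded_bilinear_mult]

lemma Ck_on_sum:
  assumes "\<And>i. i \<in> A \<Longrightarrow> Ck_on M V k (f i)"
  shows "Ck_on M V k (\<lambda>p. \<Sum>i\<in>A. f i p)"
  using assms by (induction A rule: infinite_finite_induct) (auto intro: Ck_on_const Ck_on_add)

lemma Ck_on_diff:
  assumes "Ck_on M V k f" "Ck_on M V k h"
  shows "Ck_on M V k (\<lambda>p. f p - h p)"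
  using Ck_on_add[OF assms(1) Ck_on_linear[OF bounded_linear_minus[OF bounded_linear_ident] assms(2)]]
  by simp

lemma Ck_on_ident: "Ck_on M V k (\<lambda>p. p)"
  by (cases k) (auto simp del: Ck_on.simps(2) intro!: Ck_on_SucI[OF has_derivative_ident] Ck_on_const)

text \<open>The derivative of a reciprocal is built from the derivative of \<open>f\<close> and the
  reciprocal itself, so smoothness can be raised one order at a time. The same mechanism serves for
  square roots.\<close>

lemma Ck_on_inverse:
  fixes f :: "'a \<Rightarrow> real"
  assumes "Ck_on M V k f" "\<And>p. p \<in> M \<Longrightarrow> f p \<noteq> 0"
  shows "Ck_on M V k (\<lambda>p. inverse (f p))"
  using assms
proof (induction k)
  case 0
  then show ?case by (simp add: continuous_on_inverse)
next
  case (Suc k)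
  have IH: "Ck_on M V k (\<lambda>p. inverse (f p))"
    using Suc Ck_on_Suc_imp by blast
  show ?case
    by (rule Ck_on_SucI[OF Deriv.has_derivative_inverse[OF Suc.prems(2) Ck_on_Suc_has_derivative[OF Suc.prems(1)]]])
      (use Suc.prems IH in \<open>simp_all add: Ck_on_mult Ck_on_linear[OF bounded_linear_minus[OF bounded_linear_ident]]\<close>)
qed

lemma Ck_on_sqrt:
  assumes "Ck_on M V k f" "\<And>p. p \<in> M \<Longrightarrow> f p > 0"
  shows "Ck_on M V k (\<lambda>p. sqrt (f p))"
  using assms
proof (induction k)
  case 0
  then show ?case by (simp add: continuous_on_real_sqrt)
next
  case (Suc k)
  have IH: "Ck_on M V k (\<lambda>p. sqrt (f p))"
    using Suc Ck_on_Suc_imp by blast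
  have "Ck_on M V k (\<lambda>p. inverse (sqrt (f p)))"
    using Suc.prems(2) by (intro Ck_on_inverse IH) force
  moreover have "((\<lambda>p. sqrt (f p)) has_derivative
      (\<lambda>h. frechet_derivative f (at p within M) h * (inverse (sqrt (f p)) * (1 / 2)))) (at p within M)"
    if "p \<in> M" for p
    by (rule has_derivative_real_sqrt[OF Suc.prems(2)[OF that] Ck_on_Suc_has_derivative[OF Suc.prems(1) that],
          THEN has_derivative_eq_rhs]) (auto simp: field_simps)
  ultimately show ?case
    using Suc.prems
    by (intro Ck_on_SucI[where f' = "\<lambda>p h. frechet_derivative f (at p within M) h * (inverse (sqrt (f p)) * (1 / 2))"])
      (simp_all add: Ck_on_mult Ck_on_const del: times_divide_eq_right mult_1_right)
qed

lemma Ck_on_componentwise: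
  fixes f :: "'a \<Rightarrow> 'b::euclidean_space"
  assumes "\<And>b. b \<in> Basis \<Longrightarrow> Ck_on M V k (\<lambda>p. f p \<bullet> b)"
  shows "Ck_on M V k f"
proof -
  have "Ck_on M V k (\<lambda>p. \<Sum>b\<in>Basis. (f p \<bullet> b) *\<^sub>R b)"
    by (intro Ck_on_sum Ck_on_linear[OF bounded_linear_scaleR_left] assms)
  then show ?thesis
    by (simp add: euclidean_representation)
qed

lemma Ck_on_matrix:
  fixes f :: "'a \<Rightarrow> ('n::finite) sqmat"
  assumes "\<And>i j. Ck_on M V k (\<lambda>p. f p $ i $ j)"
  shows "Ck_on M V k f"
proof (rule Ck_on_componentwise)
  fix b :: "'n sqmat" assume "b \<in> Basis"
  then obtain i j where b: "b = axis i (axis j 1)"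
    by (auto simp: Basis_vec_def)
  show "Ck_on M V k (\<lambda>p. f p \<bullet> b)"
    using assms by (simp add: b inner_axis)
qed

lemma Ck_on_component:
  fixes f :: "'a \<Rightarrow> ('n::finite) sqmat"
  assumes "Ck_on M V k f"
  shows "Ck_on M V k (\<lambda>p. f p $ i $ j)"
  using Ck_on_linear[OF bounded_linear_compose[OF bounded_linear_vec_nth bounded_linear_vec_nth] assms] .

section \<open>Symmetry of second derivatives\<close>

lemma has_real_derivative_line:
  fixes f :: "'a \<Rightarrow> real"
  assumes "p + t *\<^sub>R X \<in> M" "X \<in> V" "(f has_derivative f') (at (p + t *\<^sub>R X) within M)"
  shows "((\<lambda>t. f (p + t *\<^sub>R X)) has_real_derivative f' X) (at t)"
proof -
  have "((\<lambda>r. f (p + t *\<^sub>R X + r *\<^sub>R X)) has_real_derivative f' X) (at 0)"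
    using has_vector_derivative_line[OF assms] by (simp add: has_real_derivative_iff_has_vector_derivative)
  moreover have "(\<lambda>r. f (p + t *\<^sub>R X + r *\<^sub>R X)) = (\<lambda>r. f (p + (r + t) *\<^sub>R X))"
    by (simp add: algebra_simps)
  ultimately show ?thesis
    using DERIV_shift[of "\<lambda>t. f (p + t *\<^sub>R X)" "f' X" 0 t] by simp
qed

text \<open>The second difference is an increment of an increment. The mean value theorem in
  direction \<open>X\<close> replaces it by a difference of two first derivatives, and
  differentiability of \<open>f' q X\<close> at \<open>p\<close> evaluates both to first
  order.\<close>

lemma second_difference_estimate:
  fixes f :: "'a \<Rightarrow> real"
  assumes p: "p \<in> M" and X: "X \<in> V" and Y: "Y \<in> V"
    and f': "\<And>q. q \<in> M \<Longrightarrow> (f has_derivative f' q) (at q within M)"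
    and A: "((\<lambda>q. f' q X) has_derivative A) (at p within M)"
    and "\<epsilon> > 0"
  shows "\<exists>\<delta>>0. \<forall>s. 0 < s \<and> s < \<delta> \<longrightarrow>
    \<bar>f (p + s *\<^sub>R X + s *\<^sub>R Y) - f (p + s *\<^sub>R X) - f (p + s *\<^sub>R Y) + f p - s\<^sup>2 * A Y\<bar> \<le> \<epsilon> * s\<^sup>2"
proof -
  interpret A: bounded_linear A
    using A by (rule has_derivative_bounded_linear)
  define K where "K = norm X + norm Y + 1"
  have K: "K > 0"
    by (simp add: K_def add_nonneg_pos)
  \<comment> \<open>Half of the error is reserved for each of the two points where \<open>f'\<close>
    is evaluated; these lie within \<open>s * K\<close> of \<open>p\<close>, so the factor
    \<open>K\<close> cancels.\<close>
  have "\<epsilon> / (2 * K) > 0"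
    using K \<open>\<epsilon> > 0\<close> by simp
  then obtain d where d: "d > 0" "\<And>y. y \<in> M \<Longrightarrow> norm (y - p) < d \<Longrightarrow>
      \<bar>f' y X - f' p X - A (y - p)\<bar> \<le> \<epsilon> / (2 * K) * norm (y - p)"
    using A unfolding has_derivative_within_alt real_norm_def by blast
  obtain e where e: "e > 0" "\<And>X. X \<in> V \<Longrightarrow> norm X < e \<Longrightarrow> p + X \<in> M"
    using rel_open[OF p] by auto
  have *: "\<bar>f (p + s *\<^sub>R X + s *\<^sub>R Y) - f (p + s *\<^sub>R X) - f (p + s *\<^sub>R Y) + f p - s\<^sup>2 * A Y\<bar> \<le> \<epsilon> * s\<^sup>2"
    if s: "0 < s" "s < min d e / K" for s
  proof -
    have sK: "s * K < min d e"
      using s(2) K by (simp only: pos_less_divide_eq)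
    have small: "norm (t *\<^sub>R X + r *\<^sub>R Y) \<le> s * K" if "0 \<le> t" "t \<le> s" "0 \<le> r" "r \<le> s" for t r
    proof -
      have "norm (t *\<^sub>R X + r *\<^sub>R Y) \<le> t * norm X + r * norm Y"
        using norm_triangle_ineq[of "t *\<^sub>R X" "r *\<^sub>R Y"] that by simp
      also have "\<dots> \<le> s * norm X + s * norm Y"
        using that by (intro add_mono mult_right_mono) auto
      finally show ?thesis
        using s(1) by (simp add: K_def distrib_left)
    qed
    have inM: "p + (t *\<^sub>R X + r *\<^sub>R Y) \<in> M" if "0 \<le> t" "t \<le> s" "0 \<le> r" "r \<le> s" for t r
      using small[OF that] sK X Y by (intro e subspace_add subspace_scale subspace) auto
    have est: "\<bar>f' (p + (t *\<^sub>R X + r *\<^sub>R Y)) X - f' p X - (t * A X + r * A Y)\<bar> \<le> \<epsilon> / (2 * K) * (s * K)"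
      if "0 \<le> t" "t \<le> s" "0 \<le> r" "r \<le> s" for t r
    proof -
      have "\<bar>f' (p + (t *\<^sub>R X + r *\<^sub>R Y)) X - f' p X - A (p + (t *\<^sub>R X + r *\<^sub>R Y) - p)\<bar>
          \<le> \<epsilon> / (2 * K) * norm (p + (t *\<^sub>R X + r *\<^sub>R Y) - p)"
        using small[OF that] sK by (intro d(2) inM that) auto
      also have "\<dots> \<le> \<epsilon> / (2 * K) * (s * K)"
        using small[OF that] K \<open>\<epsilon> > 0\<close> by (intro mult_left_mono) auto
      finally show ?thesis
        by (simp add: A.add A.scaleR)
    qed
    define h where "h = (\<lambda>t. f (p + s *\<^sub>R Y + t *\<^sub>R X) - f (p + t *\<^sub>R X))"
    have "\<exists>z>0. z < s \<and> h s - h 0 = (s - 0) * (f' (p + s *\<^sub>R Y + z *\<^sub>R X) X - f' (p + z *\<^sub>R X) X)"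
    proof (rule MVT2[OF s(1)])
      fix t assume t: "0 \<le> t" "t \<le> s"
      have "p + s *\<^sub>R Y + t *\<^sub>R X \<in> M" "p + t *\<^sub>R X \<in> M"
        using inM[of t s] inM[of t 0] t s by (simp_all add: algebra_simps)
      then show "(h has_real_derivative f' (p + s *\<^sub>R Y + t *\<^sub>R X) X - f' (p + t *\<^sub>R X) X) (at t)"
        unfolding h_def by (intro DERIV_diff has_real_derivative_line X f')
    qed
    then obtain z where z: "0 < z" "z < s"
      and h: "h s - h 0 = s * (f' (p + s *\<^sub>R Y + z *\<^sub>R X) X - f' (p + z *\<^sub>R X) X)"
      by auto
    have "\<bar>f' (p + s *\<^sub>R Y + z *\<^sub>R X) X - f' p X - (z * A X + s * A Y)\<bar> \<le> \<epsilon> / 2 * s"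
        "\<bar>f' (p + z *\<^sub>R X) X - f' p X - z * A X\<bar> \<le> \<epsilon> / 2 * s"
      using est[of z s] est[of z 0] z K by (simp_all add: algebra_simps)
    then have "\<bar>f' (p + s *\<^sub>R Y + z *\<^sub>R X) X - f' (p + z *\<^sub>R X) X - s * A Y\<bar> \<le> \<epsilon> * s"
      by linarith
    then have "s * \<bar>f' (p + s *\<^sub>R Y + z *\<^sub>R X) X - f' (p + z *\<^sub>R X) X - s * A Y\<bar> \<le> s * (\<epsilon> * s)"
      using s(1) by (intro mult_left_mono) auto
    also have "s * \<bar>f' (p + s *\<^sub>R Y + z *\<^sub>R X) X - f' (p + z *\<^sub>R X) X - s * A Y\<bar>
        = \<bar>h s - h 0 - s\<^sup>2 * A Y\<bar>"
    proof -
      have "h s - h 0 - s\<^sup>2 * A Y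
          = s * (f' (p + s *\<^sub>R Y + z *\<^sub>R X) X - f' (p + z *\<^sub>R X) X - s * A Y)"
        unfolding h by (simp add: algebra_simps power2_eq_square)
      then show ?thesis
        using s(1) by (simp add: abs_mult)
    qed
    finally show ?thesis
      by (simp add: h_def algebra_simps power2_eq_square)
  qed
  show ?thesis
    using d(1) e(1) K * by (intro exI[of _ "min d e / K"]) auto
qed

text \<open>The second difference is symmetric in \<open>X\<close> and \<open>Y\<close>, so
  \<open>s\<^sup>2 * A Y\<close> and \<open>s\<^sup>2 * B X\<close> both approximate it with an
  error small compared with \<open>s\<^sup>2\<close>.\<close>

lemma second_derivative_symmetric_real:
  fixes f :: "'a \<Rightarrow> real"
  assumes p: "p \<in> M" and X: "X \<in> V" and Y: "Y \<in> V"
    and f': "\<And>q. q \<in> M \<Longrightarrow> (f has_derivative f' q) (at q within M)"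
    and A: "((\<lambda>q. f' q X) has_derivative A) (at p within M)"
    and B: "((\<lambda>q. f' q Y) has_derivative B) (at p within M)"
  shows "A Y = B X"
proof -
  have "\<bar>A Y - B X\<bar> \<le> 0 + \<epsilon>" if "\<epsilon> > 0" for \<epsilon>
  proof -
    have "\<epsilon> / 2 > 0"
      using that by simp
    from second_difference_estimate[OF p X Y f' A this] second_difference_estimate[OF p Y X f' B this]
    obtain c d where c: "c > 0" "\<And>s. 0 < s \<and> s < c \<Longrightarrow>
        \<bar>f (p + s *\<^sub>R X + s *\<^sub>R Y) - f (p + s *\<^sub>R X) - f (p + s *\<^sub>R Y) + f p - s\<^sup>2 * A Y\<bar> \<le> \<epsilon> / 2 * s\<^sup>2"
      and d: "d > 0" "\<And>s. 0 < s \<and> s < d \<Longrightarrow>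
        \<bar>f (p + s *\<^sub>R Y + s *\<^sub>R X) - f (p + s *\<^sub>R Y) - f (p + s *\<^sub>R X) + f p - s\<^sup>2 * B X\<bar> \<le> \<epsilon> / 2 * s\<^sup>2"
      by blast
    define s where "s = min c d / 2"
    have s: "0 < s \<and> s < c" "0 < s \<and> s < d"
      using c(1) d(1) by (auto simp: s_def)
    have "p + s *\<^sub>R Y + s *\<^sub>R X = p + s *\<^sub>R X + s *\<^sub>R Y"
      by simp
    with c(2)[OF s(1)] d(2)[OF s(2)] have "\<bar>s\<^sup>2 * A Y - s\<^sup>2 * B X\<bar> \<le> \<epsilon> * s\<^sup>2"
      by (simp only:)
    moreover have "\<bar>s\<^sup>2 * A Y - s\<^sup>2 * B X\<bar> = s\<^sup>2 * \<bar>A Y - B X\<bar>"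
      unfolding right_diff_distrib[symmetric] by (simp add: abs_mult)
    ultimately have "s\<^sup>2 * \<bar>A Y - B X\<bar> \<le> s\<^sup>2 * \<epsilon>"
      by (simp add: mult.commute)
    then show ?thesis
      using s(1) by simp
  qed
  then show ?thesis
    using field_le_epsilon[of "\<bar>A Y - B X\<bar>" 0] by simp
qed

lemma second_derivative_symmetric:
  fixes f :: "'a \<Rightarrow> 'b::euclidean_space"
  assumes p: "p \<in> M" and X: "X \<in> V" and Y: "Y \<in> V"
    and f': "\<And>q. q \<in> M \<Longrightarrow> (f has_derivative f' q) (at q within M)"
    and A: "((\<lambda>q. f' q X) has_derivative A) (at p within M)"
    and B: "((\<lambda>q. f' q Y) has_derivative B) (at p within M)"
  shows "A Y = B X"
proof (rule euclidean_eqI)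
  fix b :: 'b
  note inner = bounded_linear.has_derivative[OF bounded_linear_inner_left[of b]]
  show "A Y \<bullet> b = B X \<bullet> b"
    by (rule second_derivative_symmetric_real[OF p X Y inner[OF f'] inner[OF A] inner[OF B]])
qed

end

section \<open>Inner products and the Levi-Civita connection\<close>

lemma inner_product_onD:
  assumes "inner_product_on U ip" "x \<in> U" "y \<in> U"
  shows "z \<in> U \<Longrightarrow> ip (x + y) z = ip x z + ip y z" and "ip (c *\<^sub>R x) y = c * ip x y"
    and "ip x y = ip y x" and "x \<noteq> 0 \<Longrightarrow> ip x x > 0"
  using assms unfolding inner_product_on_def by simp_all

lemma inner_product_on_zero:
  assumes "inner_product_on U ip" "subspace U" "x \<in> U"
  shows "ip 0 x = 0" "ip x 0 = 0"
proof -
  show "ip 0 x = 0"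
    using inner_product_onD(2)[OF assms(1,3,3), of 0] by simp
  then show "ip x 0 = 0"
    using inner_product_onD(3)[OF assms(1) subspace_0[OF assms(2)] assms(3)] by simp
qed

lemma inner_product_on_nonneg:
  assumes "inner_product_on U ip" "subspace U" "x \<in> U"
  shows "ip x x \<ge> 0"
  using inner_product_on_zero[OF assms] inner_product_onD(4)[OF assms(1,3,3)]
  by (cases "x = 0") simp_all

text \<open>\<open>ip\<close> is unconstrained off \<open>U\<close>. Precomposition with a
  projection gives a bilinear form on the whole space, to which the bilinear product rule
  applies.\<close>

lemma inner_product_on_extend:
  fixes U :: "'a::euclidean_space set"
  assumes "inner_product_on U ip" "subspace U"
  obtains ip' where "bounded_bilinear ip'" "\<And>x y. x \<in> U \<Longrightarrow> y \<in> U \<Longrightarrow> ip' x y = ip x y"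
proof -
  obtain P where P: "bounded_linear P" "\<And>x. P x \<in> U" "\<And>x. x \<in> U \<Longrightarrow> P x = x"
    using subspace_projection[OF assms(2)] by blast
  interpret P: bounded_linear P by fact
  note D = inner_product_onD[OF assms(1) P(2) P(2)]
  have "bilinear (\<lambda>x y. ip (P x) (P y))"
    unfolding bilinear_def
  proof (intro allI conjI linearI)
    show "ip (P (x + y)) (P z) = ip (P x) (P z) + ip (P y) (P z)" for x y z
      by (simp add: P.add D(1) P(2))
    then show "ip (P z) (P (x + y)) = ip (P z) (P x) + ip (P z) (P y)" for x y z
      using D(3) by metis
    show "ip (P (c *\<^sub>R x)) (P y) = c *\<^sub>R ip (P x) (P y)" for c x y
      by (simp add: P.scaleR D(2))
    then show "ip (P y) (P (c *\<^sub>R x)) = c *\<^sub>R ip (P y) (P x)" for c x y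
      using D(3) by metis
  qed
  then show ?thesis
    using that[of "\<lambda>x y. ip (P x) (P y)"] P(3) by (simp add: bilinear_conv_bounded_bilinear)
qed

lemma inner_product_on_Cauchy_Schwarz:
  fixes U :: "'a::euclidean_space set"
  assumes "inner_product_on U ip" "subspace U" "x \<in> U" "y \<in> U"
  shows "ip x y \<le> sqrt (ip x x) * sqrt (ip y y)"
proof (cases "y = 0")
  case True
  then show ?thesis
    using inner_product_on_zero[OF assms(1,2)] assms(3,4) by simp
next
  case False
  obtain ip' where ip': "bounded_bilinear ip'" "\<And>x y. x \<in> U \<Longrightarrow> y \<in> U \<Longrightarrow> ip' x y = ip x y"
    using inner_product_on_extend[OF assms(1,2)] by blast
  interpret bounded_bilinear ip' by fact
  have pos: "ip y y > 0" and sym: "ip y x = ip x y"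
    using inner_product_onD[OF assms(1)] assms False by simp_all
  \<comment> \<open>A multiple of the component of \<open>x\<close> orthogonal to \<open>y\<close>,
    scaled by \<open>ip y y\<close> to avoid a quotient.\<close>
  define z where "z = ip y y *\<^sub>R x - ip x y *\<^sub>R y"
  have z: "z \<in> U"
    unfolding z_def by (intro subspace_diff subspace_scale assms)
  have "0 \<le> ip z z"
    using inner_product_on_nonneg[OF assms(1,2) z] .
  also have "ip z z = ip' z z"
    using ip'(2) z by simp
  also have "\<dots> = ip y y * (ip x x * ip y y - (ip x y)\<^sup>2)"
    by (simp add: z_def diff_left diff_right scaleR_left scaleR_right ip'(2) assms sym algebra_simps power2_eq_square)
  finally have "(ip x y)\<^sup>2 \<le> ip x x * ip y y"
    using pos by (simp add: zero_le_mult_iff)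
  then have "\<bar>ip x y\<bar> \<le> sqrt (ip x x * ip y y)"
    by (metis real_sqrt_abs real_sqrt_le_mono)
  then show ?thesis
    by (simp add: real_sqrt_mult)
qed

lemma levi_civitaD:
  assumes "levi_civita M V g G" "p \<in> M" "X \<in> V" "Y \<in> V"
  shows "G p X Y \<in> V" and "G p X Y = G p Y X"
    and "Z \<in> V \<Longrightarrow> frechet_derivative (\<lambda>q. g q Y Z) (at p within M) X = g p (G p X Y) Z + g p Y (G p X Z)"
  using assms unfolding levi_civita_def by simp_all

text \<open>The argument behind the Koszul formula: the difference of two such connections is
  symmetric in its arguments and, paired with the metric, skew in the last two slots.\<close>

lemma levi_civita_unique:
  fixes M V :: "'a::euclidean_space set"
  assumes "subspace V" and ip: "inner_product_on V (g p)" and "p \<in> M" "X \<in> V" "Y \<in> V"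
    and G: "levi_civita M V g G" and H: "levi_civita M V g H"
  shows "G p X Y = H p X Y"
proof -
  obtain b where b: "bounded_bilinear b" "\<And>x y. x \<in> V \<Longrightarrow> y \<in> V \<Longrightarrow> b x y = g p x y"
    using inner_product_on_extend[OF ip assms(1)] by blast
  interpret b: bounded_bilinear b by fact
  define S where "S = (\<lambda>X Y. G p X Y - H p X Y)"
  have GV: "G p X Y \<in> V" and HV: "H p X Y \<in> V" if "X \<in> V" "Y \<in> V" for X Y
    using levi_civitaD(1)[OF G \<open>p \<in> M\<close> that] levi_civitaD(1)[OF H \<open>p \<in> M\<close> that] .
  have SV: "S X Y \<in> V" if "X \<in> V" "Y \<in> V" for X Y
    using GV HV that assms(1) unfolding S_def by (simp add: subspace_diff)
  have S_sym: "S X Y = S Y X" if "X \<in> V" "Y \<in> V" for X Y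
    using levi_civitaD(2)[OF G \<open>p \<in> M\<close> that] levi_civitaD(2)[OF H \<open>p \<in> M\<close> that] by (simp add: S_def)
  have S_skew: "b (S X Y) Z = - b (S X Z) Y" if "X \<in> V" "Y \<in> V" "Z \<in> V" for X Y Z
  proof -
    have "g p (G p X Y) Z + g p Y (G p X Z) = g p (H p X Y) Z + g p Y (H p X Z)"
      using levi_civitaD(3)[OF G \<open>p \<in> M\<close> that(1,2)] levi_civitaD(3)[OF H \<open>p \<in> M\<close> that(1,2)] that(3)
      by simp
    then have "b (G p X Y) Z + b Y (G p X Z) = b (H p X Y) Z + b Y (H p X Z)"
      by (simp add: b(2) GV HV that)
    then have "b (S X Y) Z + b Y (S X Z) = 0"
      by (simp add: S_def b.diff_left b.diff_right)
    moreover have "b Y (S X Z) = b (S X Z) Y"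
      using inner_product_onD(3)[OF ip that(2) SV[OF that(1,3)]] that by (simp add: b(2) SV)
    ultimately show ?thesis
      by simp
  qed
  \<comment> \<open>Alternating skewness and symmetry, three times each, returns the arguments to
    their original order with three changes of sign.\<close>
  have "b (S X Y) Z = - b (S X Y) Z" if "X \<in> V" "Y \<in> V" "Z \<in> V" for X Y Z
    using S_skew[of X Y Z] S_sym[of X Z] S_skew[of Z X Y] S_sym[of Z Y] S_skew[of Y Z X] S_sym[of Y X] that
    by simp
  from this[OF assms(4,5) SV[OF assms(4,5)]] have "g p (S X Y) (S X Y) = 0"
    using SV[OF assms(4,5)] by (simp add: b(2))
  then have "S X Y = 0"
    using inner_product_onD(4)[OF ip SV[OF assms(4,5)] SV[OF assms(4,5)]] by force
  then show ?thesis
    by (simp add: S_def)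
qed

lemma levi_civita_imp_christoffel:
  fixes M V :: "'a::euclidean_space set"
  assumes "subspace V" "inner_product_on V (g p)" "p \<in> M" "X \<in> V" "Y \<in> V" "levi_civita M V g G"
  shows "christoffel M V g p X Y = G p X Y"
proof (rule levi_civita_unique[OF assms(1-5) _ assms(6)])
  show "levi_civita M V g (christoffel M V g)"
    unfolding christoffel_def using someI[of "levi_civita M V g", OF assms(6)] .
qed

section \<open>Global charts onto an affine space\<close>

text \<open>\<open>N_add\<close> makes \<open>N\<close> closed under all translations from
  \<open>U\<close>. Lines can then be followed for all time, which is the source of completeness and
  of an exponential map defined on all of \<open>V\<close>.\<close>

locale affine_chart = dom: open_in_affine M V + cod: open_in_affine N U
  for M V :: "'a::euclidean_space set" and N U :: "'b::euclidean_space set" +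
  fixes T :: "'a \<Rightarrow> 'b" and F :: "'b \<Rightarrow> 'a" and ip :: "'b \<Rightarrow> 'b \<Rightarrow> real"
  assumes N_add: "y \<in> N \<Longrightarrow> u \<in> U \<Longrightarrow> y + u \<in> N"
    and smooth_T: "smooth_fun_on M V T" and smooth_F: "smooth_fun_on N U F"
    and T_in: "p \<in> M \<Longrightarrow> T p \<in> N" and F_in: "y \<in> N \<Longrightarrow> F y \<in> M"
    and FT: "p \<in> M \<Longrightarrow> F (T p) = p" and TF: "y \<in> N \<Longrightarrow> T (F y) = y"
    and ip: "inner_product_on U ip"
begin

definition dT :: "'a \<Rightarrow> 'a \<Rightarrow> 'b" where
  "dT p = frechet_derivative T (at p within M)"

definition dF :: "'b \<Rightarrow> 'b \<Rightarrow> 'a" where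
  "dF y = frechet_derivative F (at y within N)"

text \<open>The last argument is the direction of differentiation, the ones before it are held
  constant; \<open>ddF\<close> and \<open>dddT\<close> follow the same convention.\<close>

definition ddT :: "'a \<Rightarrow> 'a \<Rightarrow> 'a \<Rightarrow> 'b" where
  "ddT p X = frechet_derivative (\<lambda>q. dT q X) (at p within M)"

definition ddF :: "'b \<Rightarrow> 'b \<Rightarrow> 'b \<Rightarrow> 'a" where
  "ddF y u = frechet_derivative (\<lambda>z. dF z u) (at y within N)"

definition dddT :: "'a \<Rightarrow> 'a \<Rightarrow> 'a \<Rightarrow> 'a \<Rightarrow> 'b" where
  "dddT p X Y = frechet_derivative (\<lambda>q. ddT q X Y) (at p within M)"

definition metric :: "'a \<Rightarrow> 'a \<Rightarrow> 'a \<Rightarrow> real" where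
  "metric p X Y = ip (dT p X) (dT p Y)"

definition conn :: "'a \<Rightarrow> 'a \<Rightarrow> 'a \<Rightarrow> 'a" where
  "conn p X Y = dF (T p) (ddT p X Y)"

lemma Ck_on_dT: "X \<in> V \<Longrightarrow> Ck_on M V k (\<lambda>p. dT p X)"
  using smooth_T unfolding smooth_fun_on_def dT_def by (metis Ck_on.simps(2))

lemma Ck_on_dF: "u \<in> U \<Longrightarrow> Ck_on N U k (\<lambda>y. dF y u)"
  using smooth_F unfolding smooth_fun_on_def dF_def by (metis Ck_on.simps(2))

lemma Ck_on_ddT: "X \<in> V \<Longrightarrow> Y \<in> V \<Longrightarrow> Ck_on M V k (\<lambda>p. ddT p X Y)"
  using Ck_on_dT[of X "Suc k"] unfolding ddT_def by simp

lemma dT: "p \<in> M \<Longrightarrow> (T has_derivative dT p) (at p within M)"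
  using smooth_T dom.Ck_on_Suc_has_derivative[of 0 T p] unfolding smooth_fun_on_def dT_def by blast

lemma dF: "y \<in> N \<Longrightarrow> (F has_derivative dF y) (at y within N)"
  using smooth_F cod.Ck_on_Suc_has_derivative[of 0 F y] unfolding smooth_fun_on_def dF_def by blast

lemma ddT: "p \<in> M \<Longrightarrow> X \<in> V \<Longrightarrow> ((\<lambda>q. dT q X) has_derivative ddT p X) (at p within M)"
  using Ck_on_dT[of X "Suc 0"] dom.Ck_on_Suc_has_derivative unfolding ddT_def by blast

lemma ddF: "y \<in> N \<Longrightarrow> u \<in> U \<Longrightarrow> ((\<lambda>z. dF z u) has_derivative ddF y u) (at y within N)"
  using Ck_on_dF[of u "Suc 0"] cod.Ck_on_Suc_has_derivative unfolding ddF_def by blast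

lemma dddT:
  "p \<in> M \<Longrightarrow> X \<in> V \<Longrightarrow> Y \<in> V \<Longrightarrow> ((\<lambda>q. ddT q X Y) has_derivative dddT p X Y) (at p within M)"
  using Ck_on_ddT[of X Y "Suc 0"] dom.Ck_on_Suc_has_derivative unfolding dddT_def by blast

lemma bounded_linear_dT: "p \<in> M \<Longrightarrow> bounded_linear (dT p)"
  using dT by (rule has_derivative_bounded_linear)

lemma bounded_linear_dF: "y \<in> N \<Longrightarrow> bounded_linear (dF y)"
  using dF by (rule has_derivative_bounded_linear)

lemma linear_ddT: "p \<in> M \<Longrightarrow> X \<in> V \<Longrightarrow> linear (ddT p X)"
  using ddT by (intro bounded_linear.linear has_derivative_bounded_linear)

lemma dT_mem: "p \<in> M \<Longrightarrow> X \<in> V \<Longrightarrow> dT p X \<in> U"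
  by (rule dom.has_derivative_mem_subspace[OF _ _ dT cod.subspace]) (auto intro: cod.diff_mem T_in)

lemma dF_mem: "y \<in> N \<Longrightarrow> u \<in> U \<Longrightarrow> dF y u \<in> V"
  by (rule cod.has_derivative_mem_subspace[OF _ _ dF dom.subspace]) (auto intro: dom.diff_mem F_in)

lemma ddT_mem: "p \<in> M \<Longrightarrow> X \<in> V \<Longrightarrow> Y \<in> V \<Longrightarrow> ddT p X Y \<in> U"
  by (rule dom.has_derivative_mem_subspace[OF _ _ ddT cod.subspace])
    (auto intro: subspace_diff[OF cod.subspace] dT_mem)

lemma dF_dT:
  assumes "p \<in> M" "X \<in> V"
  shows "dF (T p) (dT p X) = X"
proof -
  have "((\<lambda>q. F (T q)) has_derivative (\<lambda>X. dF (T p) (dT p X))) (at p within M)"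
    by (rule has_derivative_in_compose2[where t = N]) (use assms T_in in \<open>auto intro: dF dT\<close>)
  moreover have "((\<lambda>q. F (T q)) has_derivative (\<lambda>X. X)) (at p within M)"
    by (rule has_derivative_transform[OF assms(1) FT has_derivative_ident])
  ultimately show ?thesis
    using dom.has_derivative_unique_on[OF assms] by blast
qed

lemma dT_dF:
  assumes "y \<in> N" "u \<in> U"
  shows "dT (F y) (dF y u) = u"
proof -
  have "((\<lambda>z. T (F z)) has_derivative (\<lambda>u. dT (F y) (dF y u))) (at y within N)"
    by (rule has_derivative_in_compose2[where t = M]) (use assms F_in in \<open>auto intro: dF dT\<close>)
  moreover have "((\<lambda>z. T (F z)) has_derivative (\<lambda>u. u)) (at y within N)"
    by (rule has_derivative_transform[OF assms(1) TF has_derivative_ident])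
  ultimately show ?thesis
    using cod.has_derivative_unique_on[OF assms] by blast
qed

lemma dT_inj: "p \<in> M \<Longrightarrow> X \<in> V \<Longrightarrow> Y \<in> V \<Longrightarrow> dT p X = dT p Y \<Longrightarrow> X = Y"
  by (metis dF_dT)

lemma inv_into_dT: "p \<in> M \<Longrightarrow> u \<in> U \<Longrightarrow> inv_into V (dT p) u = dF (T p) u"
  using dT_dF[OF T_in, of p u] by (intro inv_into_f_eq inj_onI dF_mem T_in) (auto dest: dT_inj simp: FT)

lemma inv_into_T: "y \<in> N \<Longrightarrow> inv_into M T y = F y"
  by (intro inv_into_f_eq F_in TF inj_onI) (metis FT)

lemma ddT_sym: "p \<in> M \<Longrightarrow> X \<in> V \<Longrightarrow> Y \<in> V \<Longrightarrow> ddT p X Y = ddT p Y X"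
  by (rule dom.second_derivative_symmetric[where f = T and f' = dT]) (auto intro: dT ddT)

lemma conn_mem: "p \<in> M \<Longrightarrow> X \<in> V \<Longrightarrow> Y \<in> V \<Longrightarrow> conn p X Y \<in> V"
  unfolding conn_def by (intro dF_mem T_in ddT_mem)

lemma dT_conn: "p \<in> M \<Longrightarrow> X \<in> V \<Longrightarrow> Y \<in> V \<Longrightarrow> dT p (conn p X Y) = ddT p X Y"
  using dT_dF[OF T_in ddT_mem, of p p X Y] by (simp add: conn_def FT)

lemma inner_product_on_metric:
  assumes "p \<in> M"
  shows "inner_product_on V (metric p)"
proof -
  interpret dT: bounded_linear "dT p"
    using assms by (rule bounded_linear_dT)
  \<comment> \<open>Definiteness rests on the injectivity of \<open>dT p\<close> on
    \<open>V\<close>.\<close>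
  have "ip (dT p X) (dT p X) > 0" if "X \<in> V" "X \<noteq> 0" for X
  proof -
    have "dT p X \<noteq> 0"
      using dT_inj[OF assms that(1) subspace_0[OF dom.subspace]] that(2) by (auto simp: dT.zero)
    then show ?thesis
      using inner_product_onD(4)[OF ip] dT_mem[OF assms that(1)] by blast
  qed
  then show ?thesis
    using inner_product_onD[OF ip] dT_mem[OF assms] unfolding inner_product_on_def[of V] metric_def
    by (simp add: dT.add dT.scaleR)
qed

lemma Ck_on_metric:
  assumes "X \<in> V" "Y \<in> V"
  shows "Ck_on M V k (\<lambda>p. metric p X Y)"
proof -
  obtain ip' where ip': "bounded_bilinear ip'" "\<And>x y. x \<in> U \<Longrightarrow> y \<in> U \<Longrightarrow> ip' x y = ip x y"
    using inner_product_on_extend[OF ip cod.subspace] by blast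
  have "Ck_on M V k (\<lambda>p. ip' (dT p X) (dT p Y))"
    by (rule dom.Ck_on_bilinear[OF ip'(1) Ck_on_dT[OF assms(1)] Ck_on_dT[OF assms(2)]])
  then show ?thesis
    by (subst dom.Ck_on_cong[where h = "\<lambda>p. ip' (dT p X) (dT p Y)"])
      (auto simp: metric_def ip'(2) dT_mem assms)
qed

lemma riemannian_metric: "riemannian_metric_on M V metric"
  unfolding riemannian_metric_on_def smooth_fun_on_def
  by (simp add: inner_product_on_metric Ck_on_metric)

text \<open>The second derivatives of \<open>T\<close> in the Leibniz rule are the images of
  \<open>conn\<close> under \<open>dT\<close>; torsion-freeness is the symmetry of those second
  derivatives.\<close>

lemma levi_civita_conn: "levi_civita M V metric conn"
proof -
  obtain ip' where ip': "bounded_bilinear ip'" "\<And>x y. x \<in> U \<Longrightarrow> y \<in> U \<Longrightarrow> ip' x y = ip x y"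
    using inner_product_on_extend[OF ip cod.subspace] by blast
  have compat: "frechet_derivative (\<lambda>q. metric q Y Z) (at p within M) X
      = metric p (conn p X Y) Z + metric p Y (conn p X Z)"
    if p: "p \<in> M" and X: "X \<in> V" and Y: "Y \<in> V" and Z: "Z \<in> V" for p X Y Z
  proof -
    have "((\<lambda>q. ip' (dT q Y) (dT q Z)) has_derivative
        (\<lambda>X. ip' (dT p Y) (ddT p Z X) + ip' (ddT p Y X) (dT p Z))) (at p within M)"
      by (rule bounded_bilinear.FDERIV[OF ip'(1) ddT[OF p Y] ddT[OF p Z]])
    then have "((\<lambda>q. metric q Y Z) has_derivative
        (\<lambda>X. ip' (dT p Y) (ddT p Z X) + ip' (ddT p Y X) (dT p Z))) (at p within M)"
      by (rule has_derivative_transform[rotated 2]) (simp_all add: metric_def ip'(2) dT_mem that)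
    from dom.frechet_derivative_eq[OF p X this] show ?thesis
      by (simp add: metric_def dT_conn that ip'(2) dT_mem ddT_mem ddT_sym[OF p X])
  qed
  have sym: "conn p X Y = conn p Y X" if "p \<in> M" "X \<in> V" "Y \<in> V" for p X Y
    using ddT_sym[OF that] by (simp add: conn_def)
  have lin: "conn p X (Y + Z) = conn p X Y + conn p X Z" "conn p X (c *\<^sub>R Y) = c *\<^sub>R conn p X Y"
    if "p \<in> M" "X \<in> V" for p X Y Z and c :: real
    using linear_ddT[OF that] bounded_linear.linear[OF bounded_linear_dF[OF T_in[OF that(1)]]]
    by (simp_all add: conn_def linear_add linear_scale)
  \<comment> \<open>Linearity of \<open>ddT\<close> is immediate only in its last argument; symmetry
    carries it over to the other one.\<close>
  have "conn p (X + Y) Z = conn p X Z + conn p Y Z" "conn p (c *\<^sub>R X) Z = c *\<^sub>R conn p X Z"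
    if "p \<in> M" "X \<in> V" "Y \<in> V" "Z \<in> V" for p X Y Z and c :: real
    using that lin[OF that(1,4)] sym[OF that(1) subspace_add[OF dom.subspace that(2,3)] that(4)]
      sym[OF that(1) subspace_scale[OF dom.subspace that(2)] that(4)]
      sym[OF that(1,2,4)] sym[OF that(1,3,4)] by simp_all
  then show ?thesis
    unfolding levi_civita_def using compat sym conn_mem by simp
qed

lemma christoffel_eq: "p \<in> M \<Longrightarrow> X \<in> V \<Longrightarrow> Y \<in> V \<Longrightarrow> christoffel M V metric p X Y = conn p X Y"
  by (rule levi_civita_imp_christoffel[OF dom.subspace inner_product_on_metric _ _ _ levi_civita_conn])

text \<open>For \<open>v\<close> in \<open>V\<close>, symmetry of \<open>ddT\<close> and
  \<open>dT_conn\<close> show that the derivative found here is the image under \<open>dT\<close> of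
  the covariant derivative \<open>w + conn (\<gamma> t) v (W t)\<close>.\<close>

lemma dT_curve:
  assumes "t \<in> I" and \<gamma>: "\<And>s. s \<in> I \<Longrightarrow> \<gamma> s \<in> M" "(\<gamma> has_vector_derivative v) (at t within I)"
    and W: "\<And>s. s \<in> I \<Longrightarrow> W s \<in> V" "(W has_vector_derivative w) (at t within I)"
  shows "((\<lambda>s. dT (\<gamma> s) (W s)) has_vector_derivative ddT (\<gamma> t) (W t) v + dT (\<gamma> t) w) (at t within I)"
proof -
  have "((\<lambda>s. dT (\<gamma> s) X) has_derivative (\<lambda>h. h *\<^sub>R ddT (\<gamma> t) X v)) (at t within I)" if "X \<in> V" for X
    using has_vector_derivative_compose_within[OF ddT[OF \<gamma>(1)[OF assms(1)] that] _ \<gamma>(2)] \<gamma>(1)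
    by (auto simp: has_vector_derivative_def)
  then have "((\<lambda>s. dT (\<gamma> s) (W s)) has_derivative
      (\<lambda>h. h *\<^sub>R ddT (\<gamma> t) (W t) v + dT (\<gamma> t) (h *\<^sub>R w))) (at t within I)"
    using W(2) unfolding has_vector_derivative_def
    by (rule has_derivative_linear_family[OF dom.subspace, rotated])
      (use assms in \<open>auto intro: bounded_linear.linear bounded_linear_dT\<close>)
  then show ?thesis
    using bounded_linear_dT[OF \<gamma>(1)[OF assms(1)]]
    by (simp add: has_vector_derivative_def bounded_linear.linear linear_scale scaleR_add_right)
qed

text \<open>Only differentiability is recorded; the derivative itself is later identified through
  its image under \<open>dT\<close>. The parameter is a real number for curves and a point of
  \<open>M\<close> for the curvature.\<close>

lemma dF_curve_differentiable:
  assumes "t \<in> I" and c: "\<And>s. s \<in> I \<Longrightarrow> c s \<in> N" "(c has_derivative c') (at t within I)"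
    and w: "\<And>s. s \<in> I \<Longrightarrow> w s \<in> U" "(w has_derivative w') (at t within I)"
  shows "(\<lambda>s. dF (c s) (w s)) differentiable (at t within I)"
proof -
  have "((\<lambda>s. dF (c s) u) has_derivative (\<lambda>h. ddF (c t) u (c' h))) (at t within I)" if "u \<in> U" for u
    by (rule has_derivative_in_compose2[where t = N and g = "\<lambda>z. dF z u" and g' = "\<lambda>z. ddF z u"])
      (use assms that in \<open>auto intro: ddF\<close>)
  then have "((\<lambda>s. dF (c s) (w s)) has_derivative
      (\<lambda>h. ddF (c t) (w t) (c' h) + dF (c t) (w' h))) (at t within I)"
    by (rule has_derivative_linear_family[OF cod.subspace, rotated])
      (use assms in \<open>auto intro: bounded_linear.linear bounded_linear_dF\<close>)
  then show ?thesis
    by (rule differentiableI)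
qed

section \<open>Parallel fields and geodesics\<close>

lemma at_within_interval_neq_bot:
  fixes I :: "real set"
  assumes "is_interval I" "0 \<in> I" "1 \<in> I" "t \<in> I"
  shows "at t within I \<noteq> bot"
proof -
  have "\<nexists>a. I = {a}"
    using assms(2,3) by (metis singletonD zero_neq_one)
  then show ?thesis
    using connected_imp_perfect[OF is_interval_connected[OF assms(1)] assms(4)]
    by (simp add: trivial_limit_within)
qed

lemma curve_velocity_mem:
  fixes I :: "real set"
  assumes "is_interval I" "0 \<in> I" "1 \<in> I" "t \<in> I" "\<And>s. s \<in> I \<Longrightarrow> \<gamma> s \<in> M"
    and "(\<gamma> has_vector_derivative v) (at t within I)"
  shows "v \<in> V"
  using assms(4,5)
  by (intro has_vector_derivative_mem_subspace[OF assms(6) at_within_interval_neq_bot[OF assms(1-4)]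
        dom.subspace]) (auto intro: dom.diff_mem)

text \<open>By symmetry of \<open>ddT\<close>, the connection term cancels the variation of
  \<open>dT\<close> along the curve. The velocity is a separate parameter so that the lemma covers
  geodesics, with \<open>W = v\<close>, as well as transport.\<close>

lemma parallel_imp_dT_constant:
  fixes I :: "real set"
  assumes I: "is_interval I" "0 \<in> I" "1 \<in> I" and t: "t \<in> I"
    and \<gamma>: "\<And>s. s \<in> I \<Longrightarrow> \<gamma> s \<in> M" "\<And>s. s \<in> I \<Longrightarrow> (\<gamma> has_vector_derivative v s) (at s within I)"
    and W: "\<And>s. s \<in> I \<Longrightarrow> W s \<in> V"
      "\<And>s. s \<in> I \<Longrightarrow> (W has_vector_derivative - christoffel M V metric (\<gamma> s) (v s) (W s)) (at s within I)"
  shows "dT (\<gamma> t) (W t) = dT (\<gamma> 0) (W 0)"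
proof (rule has_derivative_zero_unique[OF _ _ t I(2)])
  show "convex I"
    using I(1) by (rule is_interval_convex)
  fix s assume s: "s \<in> I"
  have v: "v s \<in> V"
    using curve_velocity_mem[OF I s \<gamma>(1) \<gamma>(2)[OF s]] .
  have "dT (\<gamma> s) (- conn (\<gamma> s) (v s) (W s)) = - ddT (\<gamma> s) (W s) (v s)"
    using dT_conn[OF \<gamma>(1)[OF s] v W(1)[OF s]] ddT_sym[OF \<gamma>(1)[OF s] v W(1)[OF s]]
      linear_neg[OF bounded_linear.linear[OF bounded_linear_dT[OF \<gamma>(1)[OF s]]]] by simp
  with dT_curve[OF s \<gamma>(1) \<gamma>(2)[OF s] W(1) W(2)[OF s]]
  show "((\<lambda>s. dT (\<gamma> s) (W s)) has_derivative (\<lambda>h. 0)) (at s within I)"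
    by (simp add: christoffel_eq \<gamma>(1) s v W(1) has_vector_derivative_def)
qed

text \<open>The velocity of a geodesic is parallel along it, so the image curve moves with constant
  velocity \<open>u\<close>; subtracting \<open>t *\<^sub>R u\<close> leaves a function with
  derivative zero.\<close>

lemma geodesic_imp_line:
  fixes I :: "real set"
  assumes I: "is_interval I" "0 \<in> I" "1 \<in> I" and "geodesic_on M V metric I \<gamma>"
  shows "\<exists>u\<in>U. \<forall>t\<in>I. \<gamma> t = F (T (\<gamma> 0) + t *\<^sub>R u)"
proof -
  obtain v where \<gamma>: "\<And>t. t \<in> I \<Longrightarrow> \<gamma> t \<in> M" "\<And>t. t \<in> I \<Longrightarrow> (\<gamma> has_vector_derivative v t) (at t within I)"
    and v: "\<And>t. t \<in> I \<Longrightarrow> (v has_vector_derivative - christoffel M V metric (\<gamma> t) (v t) (v t)) (at t within I)"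
    using assms(4) unfolding geodesic_on_def by blast
  have vV: "v t \<in> V" if "t \<in> I" for t
    using curve_velocity_mem[OF I that \<gamma>(1) \<gamma>(2)[OF that]] .
  define u where "u = dT (\<gamma> 0) (v 0)"
  have u: "dT (\<gamma> t) (v t) = u" if "t \<in> I" for t
    unfolding u_def by (rule parallel_imp_dT_constant[OF I that \<gamma> vV v])
  have "T (\<gamma> t) - t *\<^sub>R u = T (\<gamma> 0) - 0 *\<^sub>R u" if t: "t \<in> I" for t
  proof (rule has_derivative_zero_unique[OF is_interval_convex[OF I(1)] _ t I(2)])
    fix s assume s: "s \<in> I"
    have "((\<lambda>s. T (\<gamma> s)) has_vector_derivative dT (\<gamma> s) (v s)) (at s within I)"
      by (rule has_vector_derivative_compose_within[OF dT[OF \<gamma>(1)[OF s]] _ \<gamma>(2)[OF s]]) (use \<gamma>(1) in auto)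
    then have "((\<lambda>s. T (\<gamma> s) - s *\<^sub>R u) has_vector_derivative u - 1 *\<^sub>R u) (at s within I)"
      unfolding u[OF s] by (auto intro!: derivative_eq_intros)
    then show "((\<lambda>s. T (\<gamma> s) - s *\<^sub>R u) has_derivative (\<lambda>h. 0)) (at s within I)"
      by (simp add: has_vector_derivative_def)
  qed
  then have "\<gamma> t = F (T (\<gamma> 0) + t *\<^sub>R u)" if "t \<in> I" for t
    using FT[OF \<gamma>(1)[OF that]] that by (metis diff_eq_eq diff_zero scaleR_zero_left)
  moreover have "u \<in> U"
    unfolding u_def using I(2) by (intro dT_mem \<gamma> vV)
  ultimately show ?thesis
    by blast
qed

lemma line_mem: "y \<in> N \<Longrightarrow> u \<in> U \<Longrightarrow> y + t *\<^sub>R u \<in> N"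
  by (intro N_add subspace_scale cod.subspace)

lemma line_has_vector_derivative:
  assumes "y \<in> N" "u \<in> U"
  shows "((\<lambda>t. F (y + t *\<^sub>R u)) has_vector_derivative dF (y + t *\<^sub>R u) u) (at t within I)"
proof -
  have "((\<lambda>t. y + t *\<^sub>R u) has_vector_derivative u) (at t within I)"
    by (auto intro!: derivative_eq_intros)
  then show ?thesis
    by (intro has_vector_derivative_compose_within[OF dF[OF line_mem[OF assms]]])
      (use line_mem[OF assms] in auto)
qed

text \<open>The existence half: the field with constant image \<open>w\<close> solves the transport
  equation along a line. For \<open>w = u\<close> this is the geodesic equation.\<close>

lemma line_parallel:
  assumes y: "y \<in> N" and u: "u \<in> U" and w: "w \<in> U"
  shows "((\<lambda>t. dF (y + t *\<^sub>R u) w) has_vector_derivative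
    - christoffel M V metric (F (y + t *\<^sub>R u)) (dF (y + t *\<^sub>R u) u) (dF (y + t *\<^sub>R u) w)) (at t within I)"
proof -
  define \<gamma> where "\<gamma> = (\<lambda>t. F (y + t *\<^sub>R u))"
  define W where "W = (\<lambda>t. dF (y + t *\<^sub>R u) w)"
  define v where "v = dF (y + t *\<^sub>R u) u"
  note line = line_mem[OF y u]
  have \<gamma>M: "\<gamma> s \<in> M" and WV: "W s \<in> V" and vV: "v \<in> V" for s
    by (auto simp: \<gamma>_def W_def v_def F_in dF_mem line u w)
  have \<gamma>: "(\<gamma> has_vector_derivative v) (at t)"
    unfolding \<gamma>_def v_def by (rule line_has_vector_derivative[OF y u])
  have "W differentiable (at t)"
    unfolding W_def
    by (rule dF_curve_differentiable[where I = UNIV])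
      (auto intro!: line w derivative_eq_intros)
  then obtain z where z: "(W has_vector_derivative z) (at t)"
    using vector_derivative_works by blast
  \<comment> \<open>\<open>dT\<close> is injective only on \<open>V\<close>, so the unknown
    derivative must be placed there before it can be identified.\<close>
  have zV: "z \<in> V"
    by (rule has_vector_derivative_mem_subspace[OF z _ dom.subspace])
      (auto intro: subspace_diff[OF dom.subspace] WV)
  have "((\<lambda>s. dT (\<gamma> s) (W s)) has_vector_derivative ddT (\<gamma> t) (W t) v + dT (\<gamma> t) z) (at t)"
    using dT_curve[OF UNIV_I \<gamma>M \<gamma> WV z] .
  moreover have "(\<lambda>s. dT (\<gamma> s) (W s)) = (\<lambda>s. w)"
    by (simp add: \<gamma>_def W_def dT_dF line w)
  ultimately have "ddT (\<gamma> t) (W t) v + dT (\<gamma> t) z = 0"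
    using has_vector_derivative_const vector_derivative_unique_at by metis
  then have "dT (\<gamma> t) z = - ddT (\<gamma> t) v (W t)"
    by (simp add: ddT_sym[OF \<gamma>M vV WV] eq_neg_iff_add_eq_0 add.commute)
  also have "\<dots> = dT (\<gamma> t) (- conn (\<gamma> t) v (W t))"
    by (simp only: dT_conn[OF \<gamma>M vV WV] linear_neg[OF bounded_linear.linear[OF bounded_linear_dT[OF \<gamma>M]]])
  finally have "dT (\<gamma> t) z = dT (\<gamma> t) (- conn (\<gamma> t) v (W t))" .
  then have "z = - conn (\<gamma> t) v (W t)"
    using conn_mem[OF \<gamma>M vV WV] by (intro dT_inj[OF \<gamma>M zV]) (auto intro: subspace_neg dom.subspace)
  then have "z = - christoffel M V metric (\<gamma> t) v (W t)"
    by (simp add: christoffel_eq[OF \<gamma>M vV WV])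
  then show ?thesis
    using has_vector_derivative_at_within[OF z] unfolding \<gamma>_def v_def W_def by simp
qed

lemma line_geodesic:
  assumes "y \<in> N" "u \<in> U" "\<And>t. t \<in> I \<Longrightarrow> \<gamma> t = F (y + t *\<^sub>R u)"
  shows "geodesic_on M V metric I \<gamma>"
  unfolding geodesic_on_def
proof (intro exI[of _ "\<lambda>t. dF (y + t *\<^sub>R u) u"] ballI conjI)
  fix t assume t: "t \<in> I"
  show "\<gamma> t \<in> M"
    by (simp add: assms t F_in line_mem)
  show "(\<gamma> has_vector_derivative dF (y + t *\<^sub>R u) u) (at t within I)"
    by (rule has_vector_derivative_transform[OF t assms(3) line_has_vector_derivative[OF assms(1,2)]])
  show "((\<lambda>t. dF (y + t *\<^sub>R u) u) has_vector_derivative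
      - christoffel M V metric (\<gamma> t) (dF (y + t *\<^sub>R u) u) (dF (y + t *\<^sub>R u) u)) (at t within I)"
    unfolding assms(3)[OF t] by (rule line_parallel[OF assms(1,2,2)])
qed

lemma geodesic_iff_line:
  assumes "is_interval I" "0 \<in> I" "1 \<in> I" "p \<in> M" "q \<in> M"
  shows "geodesic_on M V metric I \<gamma> \<and> \<gamma> 0 = p \<and> \<gamma> 1 = q \<longleftrightarrow>
    (\<forall>t\<in>I. \<gamma> t = F ((1 - t) *\<^sub>R T p + t *\<^sub>R T q))"
proof -
  have line: "(1 - t) *\<^sub>R T p + t *\<^sub>R T q = T p + t *\<^sub>R (T q - T p)" for t
    by (simp add: algebra_simps)
  show ?thesis
    unfolding line
  proof
    assume L: "geodesic_on M V metric I \<gamma> \<and> \<gamma> 0 = p \<and> \<gamma> 1 = q"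
    then obtain u where u: "u \<in> U" "\<And>t. t \<in> I \<Longrightarrow> \<gamma> t = F (T p + t *\<^sub>R u)"
      using geodesic_imp_line[OF assms(1-3)] by blast
    \<comment> \<open>The end point at time 1 fixes the velocity.\<close>
    have "q = F (T p + 1 *\<^sub>R u)"
      using u(2)[OF assms(3)] L by simp
    then have "T q = T p + u"
      using TF[OF line_mem[OF T_in[OF assms(4)] u(1)], of 1] by simp
    then show "\<forall>t\<in>I. \<gamma> t = F (T p + t *\<^sub>R (T q - T p))"
      using u(2) by simp
  next
    assume R: "\<forall>t\<in>I. \<gamma> t = F (T p + t *\<^sub>R (T q - T p))"
    then show "geodesic_on M V metric I \<gamma> \<and> \<gamma> 0 = p \<and> \<gamma> 1 = q"
      using assms
      by (intro conjI line_geodesic[of "T p" "T q - T p"]) (auto simp: FT T_in intro: cod.diff_mem)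
  qed
qed

section \<open>Exponential map, logarithm and parallel transport\<close>

lemma riem_exp_eq:
  assumes p: "p \<in> M" and X: "X \<in> V"
  shows "riem_exp M V metric p X = F (T p + dT p X)"
  unfolding riem_exp_def
proof (rule the_equality)
  note I = is_interval_cc[of 0 "1::real"]
  let ?\<gamma> = "\<lambda>t. F (T p + t *\<^sub>R dT p X)"
  have "(?\<gamma> has_vector_derivative dF (T p + 0 *\<^sub>R dT p X) (dT p X)) (at 0 within {0..1})"
    by (rule line_has_vector_derivative[OF T_in[OF p] dT_mem[OF p X]])
  then show "\<exists>\<gamma>. geodesic_on M V metric {0..1} \<gamma> \<and> \<gamma> 0 = p \<and>
     (\<gamma> has_vector_derivative X) (at 0 within {0..1}) \<and> \<gamma> 1 = F (T p + dT p X)"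
    using line_geodesic[OF T_in[OF p] dT_mem[OF p X], of "{0..1}" ?\<gamma>]
    by (intro exI[of _ ?\<gamma>]) (simp add: FT p dF_dT X)
  fix q assume "\<exists>\<gamma>. geodesic_on M V metric {0..1} \<gamma> \<and> \<gamma> 0 = p \<and>
     (\<gamma> has_vector_derivative X) (at 0 within {0..1}) \<and> \<gamma> 1 = q"
  then obtain \<gamma> where \<gamma>: "geodesic_on M V metric {0..1} \<gamma>" "\<gamma> 0 = p"
     "(\<gamma> has_vector_derivative X) (at 0 within {0..1})" "\<gamma> 1 = q"
    by blast
  have "\<exists>u\<in>U. \<forall>t\<in>{0..1}. \<gamma> t = F (T (\<gamma> 0) + t *\<^sub>R u)"
    by (rule geodesic_imp_line[OF I _ _ \<gamma>(1)]) simp_all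
  then obtain u where u: "u \<in> U" "\<And>t. t \<in> {0..1} \<Longrightarrow> \<gamma> t = F (T p + t *\<^sub>R u)"
    unfolding \<gamma>(2) by blast
  have "(\<gamma> has_vector_derivative dF (T p + 0 *\<^sub>R u) u) (at 0 within {0..1})"
    by (rule has_vector_derivative_transform[OF _ u(2) line_has_vector_derivative[OF T_in[OF p] u(1)]]) auto
  \<comment> \<open>The initial velocity determines \<open>u\<close>, which gives the uniqueness
    demanded by \<open>THE\<close>.\<close>
  then have "X = dF (T p) u"
    using vector_derivative_unique_within[OF at_within_interval_neq_bot[OF I] \<gamma>(3)] by simp
  then have "dT p X = u"
    using dT_dF[OF T_in[OF p] u(1)] by (simp add: FT p)
  then show "q = F (T p + dT p X)"
    using u(2)[of 1] \<gamma>(4) by simp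
qed

text \<open>The exponential map is injective on all of \<open>V\<close>, so \<open>inv_into\<close>
  is a genuine inverse; the witness is the vector that \<open>dT p\<close> sends to the displacement
  \<open>T q - T p\<close>.\<close>

lemma riem_log_eq:
  assumes p: "p \<in> M" and q: "q \<in> M"
  shows "riem_log M V metric p q = dF (T p) (T q - T p)"
  unfolding riem_log_def
proof (rule inv_into_f_eq)
  have u: "T q - T p \<in> U"
    by (intro cod.diff_mem T_in p q)
  show "dF (T p) (T q - T p) \<in> V"
    by (intro dF_mem T_in p u)
  then show "riem_exp M V metric p (dF (T p) (T q - T p)) = q"
    using dT_dF[OF T_in[OF p] u] by (simp add: riem_exp_eq p FT q)
  show "inj_on (riem_exp M V metric p) V"
  proof (rule inj_onI)
    fix X Y assume XY: "X \<in> V" "Y \<in> V" "riem_exp M V metric p X = riem_exp M V metric p Y"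
    then have "T p + dT p X = T p + dT p Y"
      using TF[OF N_add[OF T_in[OF p] dT_mem[OF p]]] by (metis riem_exp_eq p)
    then show "X = Y"
      using dT_inj[OF p] XY by simp
  qed
qed

text \<open>Transport is path independent: \<open>dT\<close> takes the same value on the field at
  both ends of the curve, and this value determines the final vector.\<close>

lemma riem_transport_eq:
  assumes p: "p \<in> M" and q: "q \<in> M" and X: "X \<in> V"
  shows "riem_transport M V metric p q X = dF (T q) (dT p X)"
  unfolding riem_transport_def
proof (rule the_equality)
  note I = is_interval_cc[of 0 "1::real"]
  define u where "u = T q - T p"
  define w where "w = dT p X"
  have u: "u \<in> U" and w: "w \<in> U"
    unfolding u_def w_def by (intro cod.diff_mem T_in dT_mem p q X)+
  let ?\<gamma> = "\<lambda>t. F (T p + t *\<^sub>R u)" and ?W = "\<lambda>t. dF (T p + t *\<^sub>R u) w"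
  have "vector_derivative ?\<gamma> (at t within {0..1}) = dF (T p + t *\<^sub>R u) u" if "t \<in> {0..1}" for t
    by (rule vector_derivative_within[OF at_within_interval_neq_bot[OF I _ _ that]
          line_has_vector_derivative[OF T_in[OF p] u]]) auto
  then have "parallel_along M V metric {0..1} ?\<gamma> ?W"
    using line_parallel[OF T_in[OF p] u w] unfolding parallel_along_def
    by (auto intro!: dF_mem line_mem T_in p u w)
  moreover have "geodesic_on M V metric {0..1} ?\<gamma>"
    by (rule line_geodesic[OF T_in[OF p] u]) simp
  moreover have "?\<gamma> 0 = p" "?\<gamma> 1 = q" "?W 0 = X" "?W 1 = dF (T q) (dT p X)"
    by (simp_all add: FT p q u_def w_def dF_dT X)
  ultimately show "\<exists>\<gamma> W. geodesic_on M V metric {0..1} \<gamma> \<and> \<gamma> 0 = p \<and> \<gamma> 1 = q \<and>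
     parallel_along M V metric {0..1} \<gamma> W \<and> W 0 = X \<and> W 1 = dF (T q) (dT p X)"
    by (intro exI[of _ ?\<gamma>] exI[of _ ?W] conjI)
  fix Y assume "\<exists>\<gamma> W. geodesic_on M V metric {0..1} \<gamma> \<and> \<gamma> 0 = p \<and> \<gamma> 1 = q \<and>
     parallel_along M V metric {0..1} \<gamma> W \<and> W 0 = X \<and> W 1 = Y"
  then obtain \<gamma> W where \<gamma>: "geodesic_on M V metric {0..1} \<gamma>" "\<gamma> 0 = p" "\<gamma> 1 = q"
     and W: "parallel_along M V metric {0..1} \<gamma> W" "W 0 = X" "W 1 = Y"
    by blast
  have "(\<gamma> has_vector_derivative vector_derivative \<gamma> (at t within {0..1})) (at t within {0..1})"
    and \<gamma>M: "\<gamma> t \<in> M" if "t \<in> {0..1}" for t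
    using \<gamma>(1) that unfolding geodesic_on_def
    by (auto simp: vector_derivative_works[symmetric] intro: differentiableI_vector)
  then have "dT (\<gamma> 1) (W 1) = dT (\<gamma> 0) (W 0)"
    using W(1) unfolding parallel_along_def by (intro parallel_imp_dT_constant[OF I]) auto
  then have "dT q Y = dT p X"
    using \<gamma> W by simp
  moreover have "Y \<in> V"
    using W unfolding parallel_along_def by auto
  ultimately show "Y = dF (T q) (dT p X)"
    using dF_dT[OF q] by metis
qed

section \<open>Curvature, completeness and distance\<close>

lemma riem_curvature_eq_0:
  assumes p: "p \<in> M" and X: "X \<in> V" and Y: "Y \<in> V" and Z: "Z \<in> V"
  shows "riem_curvature M V metric p X Y Z = 0"
proof -
  \<comment> \<open>This comes from differentiating \<open>dT q (conn q Y Z) = ddT q Z Y\<close> in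
    direction \<open>X\<close>; the product rule contributes the term with
    \<open>ddT\<close>.\<close>
  have conn_deriv: "frechet_derivative (\<lambda>q. christoffel M V metric q Y Z) (at p within M) X \<in> V \<and>
      dT p (frechet_derivative (\<lambda>q. christoffel M V metric q Y Z) (at p within M) X)
      = dddT p Z Y X - ddT p (conn p Y Z) X"
    if X: "X \<in> V" and Y: "Y \<in> V" and Z: "Z \<in> V" for X Y Z
  proof -
    define G where "G = frechet_derivative (\<lambda>q. conn q Y Z) (at p within M)"
    have "(\<lambda>q. dF (T q) (ddT q Y Z)) differentiable (at p within M)"
      by (rule dF_curve_differentiable) (use p Y Z in \<open>auto intro: T_in ddT_mem dT dddT\<close>)
    then have G: "((\<lambda>q. conn q Y Z) has_derivative G) (at p within M)"
      unfolding G_def conn_def by (simp add: frechet_derivative_works)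
    then have "((\<lambda>q. christoffel M V metric q Y Z) has_derivative G) (at p within M)"
      by (rule has_derivative_transform[rotated 2]) (simp_all add: p christoffel_eq Y Z)
    then have eq: "frechet_derivative (\<lambda>q. christoffel M V metric q Y Z) (at p within M) X = G X"
      by (rule dom.frechet_derivative_eq[OF p X])
    have GV: "G X \<in> V"
      by (rule dom.has_derivative_mem_subspace[OF p X G dom.subspace])
        (auto intro: subspace_diff[OF dom.subspace] conn_mem p Y Z)
    have "((\<lambda>q. dT q (conn q Y Z)) has_derivative (\<lambda>X. ddT p (conn p Y Z) X + dT p (G X))) (at p within M)"
      by (rule has_derivative_linear_family[OF dom.subspace _ _ G])
        (use p Y Z in \<open>auto intro: ddT conn_mem bounded_linear.linear bounded_linear_dT\<close>)
    then have "((\<lambda>q. ddT q Z Y) has_derivative (\<lambda>X. ddT p (conn p Y Z) X + dT p (G X))) (at p within M)"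
      by (rule has_derivative_transform[rotated 2]) (simp_all add: p dT_conn Y Z ddT_sym[of _ Z Y])
    from dom.has_derivative_unique_on[OF p X dddT[OF p Z Y] this] show ?thesis
      using GV by (simp add: eq)
  qed
  interpret dT: bounded_linear "dT p"
    using p by (rule bounded_linear_dT)
  \<comment> \<open>With the third derivatives gone, the remaining \<open>ddT\<close> terms are
    images under \<open>dT\<close> of the quadratic terms in the connection, with opposite
    sign.\<close>
  have "dddT p Z Y X = dddT p Z X Y"
    by (rule dom.second_derivative_symmetric[OF p Y X, where f = "\<lambda>q. dT q Z" and f' = "\<lambda>q. ddT q Z"])
      (use p X Y Z in \<open>auto intro: ddT dddT\<close>)
  then have "dT p (riem_curvature M V metric p X Y Z) = 0"
    unfolding riem_curvature_def Let_def
    by (simp add: dT.add dT.diff conn_deriv X Y Z p christoffel_eq conn_mem dT_conn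
        ddT_sym[of p X "conn p Y Z"] ddT_sym[of p Y "conn p X Z"])
  moreover have "riem_curvature M V metric p X Y Z \<in> V"
    unfolding riem_curvature_def Let_def
    by (intro subspace_add subspace_diff dom.subspace conjunct1[OF conn_deriv] X Y Z)
      (simp_all add: christoffel_eq conn_mem p X Y Z)
  ultimately show ?thesis
    using dT_inj[OF p _ subspace_0[OF dom.subspace]] dT.zero by metis
qed

lemma geodesically_complete_metric: "geodesically_complete M V metric"
  unfolding geodesically_complete_def
proof (intro ballI)
  fix p X assume p: "p \<in> M" and X: "X \<in> V"
  have "((\<lambda>t. F (T p + t *\<^sub>R dT p X)) has_vector_derivative dF (T p + 0 *\<^sub>R dT p X) (dT p X)) (at 0)"
    by (rule line_has_vector_derivative[OF T_in[OF p] dT_mem[OF p X]])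
  then show "\<exists>\<gamma>. geodesic_on M V metric UNIV \<gamma> \<and> \<gamma> 0 = p \<and> (\<gamma> has_vector_derivative X) (at 0)"
    using line_geodesic[OF T_in[OF p] dT_mem[OF p X], of UNIV]
    by (intro exI[of _ "\<lambda>t. F (T p + t *\<^sub>R dT p X)"]) (simp add: FT p dF_dT X)
qed

text \<open>Pairing the image of the curve with the fixed vector \<open>b\<close> joining its end points reduces the
  length estimate to the fundamental theorem of calculus for a real function.\<close>

lemma curve_length_ge:
  assumes \<gamma>: "\<gamma> piecewise_C1_differentiable_on {0..1}" "\<gamma> ` {0..1} \<subseteq> M"
    and int: "curve_speed metric \<gamma> integrable_on {0..1}"
  shows "sqrt (ip (T (\<gamma> 1) - T (\<gamma> 0)) (T (\<gamma> 1) - T (\<gamma> 0))) \<le> integral {0..1} (curve_speed metric \<gamma>)"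
proof -
  define b where "b = T (\<gamma> 1) - T (\<gamma> 0)"
  define n where "n = sqrt (ip b b)"
  have \<gamma>M: "\<gamma> t \<in> M" if "t \<in> {0..1}" for t
    using \<gamma>(2) that by auto
  have b: "b \<in> U"
    unfolding b_def by (intro cod.diff_mem T_in \<gamma>M) auto
  obtain ip' where ip': "bounded_bilinear ip'" "\<And>x y. x \<in> U \<Longrightarrow> y \<in> U \<Longrightarrow> ip' x y = ip x y"
    using inner_product_on_extend[OF ip cod.subspace] by blast
  obtain S where S: "finite S" "\<gamma> C1_differentiable_on ({0..1} - S)" and cont: "continuous_on {0..1} \<gamma>"
    using \<gamma>(1) unfolding piecewise_C1_differentiable_on_def by blast
  \<comment> \<open>With the end points excluded, a full neighbourhood of \<open>t\<close> is mapped
    into \<open>M\<close>, so the two-sided velocity lies in \<open>V\<close> and the chain rule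
    within \<open>M\<close> applies.\<close>
  define E where "E = insert 0 (insert 1 S)"
  have E: "finite E"
    using S(1) by (simp add: E_def)
  define v where "v = (\<lambda>t. vector_derivative \<gamma> (at t))"
  have v: "(\<gamma> has_vector_derivative v t) (at t)" if "t \<in> {0..1} - E" for t
    using S(2) that unfolding C1_differentiable_on_eq v_def vector_derivative_works[symmetric] by (auto simp: E_def)
  have open_at: "at t within {0<..<1} = at t" if "t \<in> {0..1} - E" for t :: real
    using that by (intro at_within_open) (auto simp: E_def)
  have v_within: "(\<gamma> has_vector_derivative v t) (at t within {0<..<1})" if "t \<in> {0..1} - E" for t
    using v[OF that] by (rule has_vector_derivative_at_within)
  have vV: "v t \<in> V" if t: "t \<in> {0..1} - E" for t
    by (rule has_vector_derivative_mem_subspace[OF v_within[OF t] _ dom.subspace])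
      (use t in \<open>auto simp: open_at E_def intro!: dom.diff_mem \<gamma>M\<close>)
  have Tv: "((\<lambda>t. T (\<gamma> t)) has_vector_derivative dT (\<gamma> t) (v t)) (at t)" if t: "t \<in> {0..1} - E" for t
    using has_vector_derivative_compose_within[OF dT[OF \<gamma>M] _ v_within[OF t]] \<gamma>(2) t
    by (fastforce simp: open_at)
  have contT: "continuous_on {0..1} (\<lambda>t. T (\<gamma> t))"
  proof (rule continuous_on_compose2[OF _ cont \<gamma>(2)])
    show "continuous_on M T"
      using dT by (intro has_derivative_continuous_on)
  qed
  have lin: "bounded_linear (ip' b)"
    using bounded_bilinear.bounded_linear_right[OF ip'(1)] .
  have "((\<lambda>t. ip' b (dT (\<gamma> t) (v t))) has_integral ip' b (T (\<gamma> 1)) - ip' b (T (\<gamma> 0))) {0..1}"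
    by (rule fundamental_theorem_of_calculus_interior_strong[OF E])
      (auto intro!: bounded_linear.has_vector_derivative[OF lin] Tv bounded_linear.continuous_on[OF lin contT])
  moreover have "ip' b (T (\<gamma> 1)) - ip' b (T (\<gamma> 0)) = n * n"
    using bounded_bilinear.diff_right[OF ip'(1), of b "T (\<gamma> 1)" "T (\<gamma> 0)"]
      inner_product_on_nonneg[OF ip cod.subspace b] b by (simp add: b_def[symmetric] n_def ip'(2))
  \<comment> \<open>At points of \<open>E\<close> the value of \<open>vector_derivative\<close> may
    be meaningless. Setting both integrands to 0 there preserves the integrals and makes the
    comparison hold everywhere.\<close>
  ultimately have I1: "((\<lambda>t. if t \<in> E then 0 else ip' b (dT (\<gamma> t) (v t))) has_integral n * n) {0..1}"
    using has_integral_spike_finite[OF E] by (smt (verit, best) DiffD2)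
  have I2: "((\<lambda>t. if t \<in> E then 0 else curve_speed metric \<gamma> t) has_integral integral {0..1} (curve_speed metric \<gamma>)) {0..1}"
    by (rule has_integral_spike_finite[OF E _ integrable_integral[OF int]]) simp
  have speed: "curve_speed metric \<gamma> t = sqrt (ip (dT (\<gamma> t) (v t)) (dT (\<gamma> t) (v t)))" for t
    by (simp add: curve_speed_def metric_def v_def)
  have pos: "curve_speed metric \<gamma> t \<ge> 0" if "t \<in> {0..1} - E" for t
    unfolding speed using inner_product_on_nonneg[OF ip cod.subspace dT_mem[OF \<gamma>M vV]] that by simp
  \<comment> \<open>Cauchy-Schwarz bounds the pairing with \<open>b\<close> by \<open>n\<close>
    times the speed; the common factor \<open>n\<close> is cancelled at the end.\<close>
  have "n * n \<le> n * integral {0..1} (curve_speed metric \<gamma>)"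
  proof (rule has_integral_le[OF I1 has_integral_mult_right[OF I2, of n]])
    fix t :: real assume t: "t \<in> {0..1}"
    have "ip' b (dT (\<gamma> t) (v t)) \<le> n * curve_speed metric \<gamma> t" if "t \<notin> E"
    proof -
      have u: "dT (\<gamma> t) (v t) \<in> U"
        using t that by (intro dT_mem \<gamma>M vV) auto
      show ?thesis
        using inner_product_on_Cauchy_Schwarz[OF ip cod.subspace b u] by (simp add: ip'(2) b u n_def speed)
    qed
    then show "(if t \<in> E then 0 else ip' b (dT (\<gamma> t) (v t))) \<le> n * (if t \<in> E then 0 else curve_speed metric \<gamma> t)"
      by simp
  qed
  moreover have "integral {0..1} (curve_speed metric \<gamma>) \<ge> 0"
    by (rule has_integral_nonneg[OF I2]) (use pos in auto)
  moreover have "n \<ge> 0"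
    using inner_product_on_nonneg[OF ip cod.subspace b] by (simp add: n_def)
  ultimately show ?thesis
    unfolding b_def[symmetric] n_def[symmetric] by (cases "n = 0") simp_all
qed

lemma line_length:
  assumes "y \<in> N" "u \<in> U"
  shows "curve_speed metric (\<lambda>t. F (y + t *\<^sub>R u)) t = sqrt (ip u u)"
  using vector_derivative_at[OF line_has_vector_derivative[OF assms, of t UNIV]]
  by (simp add: curve_speed_def metric_def dT_dF line_mem assms)

lemma line_C1:
  assumes "y \<in> N" "u \<in> U"
  shows "(\<lambda>t. F (y + t *\<^sub>R u)) C1_differentiable_on {0..1}"
  unfolding C1_differentiable_on_def
proof (intro exI[of _ "\<lambda>t. dF (y + t *\<^sub>R u) u"] conjI ballI)
  show "((\<lambda>t. F (y + t *\<^sub>R u)) has_vector_derivative dF (y + t *\<^sub>R u) u) (at t)" for t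
    by (rule line_has_vector_derivative[OF assms])
  show "continuous_on {0..1} (\<lambda>t. dF (y + t *\<^sub>R u) u)"
    by (rule continuous_on_vector_derivative, rule line_parallel[OF assms assms(2)])
qed

text \<open>The infimum is attained by the preimage of the segment, whose speed is constant.\<close>

lemma riem_dist_eq:
  assumes p: "p \<in> M" and q: "q \<in> M"
  shows "riem_dist M metric p q = sqrt (ip (T q - T p) (T q - T p))"
  unfolding riem_dist_def
proof (rule cInf_eq_minimum)
  define u where "u = T q - T p"
  have u: "u \<in> U"
    unfolding u_def by (intro cod.diff_mem T_in p q)
  let ?\<gamma> = "\<lambda>t. F (T p + t *\<^sub>R u)"
  have speed: "curve_speed metric ?\<gamma> = (\<lambda>t. sqrt (ip u u))"
    using line_length[OF T_in[OF p] u] by blast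
  have "?\<gamma> piecewise_C1_differentiable_on {0..1}"
    by (rule C1_differentiable_imp_piecewise[OF line_C1[OF T_in[OF p] u]])
  moreover have "?\<gamma> ` {0..1} \<subseteq> M"
    using F_in[OF line_mem[OF T_in[OF p] u]] by auto
  moreover have "?\<gamma> 0 = p" "?\<gamma> 1 = q"
    by (simp_all add: FT p q u_def)
  ultimately show "sqrt (ip (T q - T p) (T q - T p)) \<in> {integral {0..1} (curve_speed metric \<gamma>) | \<gamma>.
     \<gamma> piecewise_C1_differentiable_on {0..1} \<and> \<gamma> ` {0..1} \<subseteq> M \<and> \<gamma> 0 = p \<and> \<gamma> 1 = q \<and>
     curve_speed metric \<gamma> integrable_on {0..1}}"
    unfolding mem_Collect_eq u_def[symmetric]
    by (intro exI[of _ ?\<gamma>]) (simp add: speed integrable_const_ivl)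
next
  fix x assume "x \<in> {integral {0..1} (curve_speed metric \<gamma>) | \<gamma>.
     \<gamma> piecewise_C1_differentiable_on {0..1} \<and> \<gamma> ` {0..1} \<subseteq> M \<and> \<gamma> 0 = p \<and> \<gamma> 1 = q \<and>
     curve_speed metric \<gamma> integrable_on {0..1}}"
  then obtain \<gamma> where \<gamma>: "x = integral {0..1} (curve_speed metric \<gamma>)"
     "\<gamma> piecewise_C1_differentiable_on {0..1}" "\<gamma> ` {0..1} \<subseteq> M" "\<gamma> 0 = p" "\<gamma> 1 = q"
     "curve_speed metric \<gamma> integrable_on {0..1}"
    by blast
  show "sqrt (ip (T q - T p) (T q - T p)) \<le> x"
    using curve_length_ge[OF \<gamma>(2,3,6)] by (simp add: \<gamma>(1,4,5))
qed

section \<open>Frechet means\<close>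

lemma mean_mem:
  fixes k :: nat
  assumes k: "k \<ge> 1" and Cs: "\<And>i. i \<in> {1..k} \<Longrightarrow> Cs i \<in> M"
  shows "(1 / real k) *\<^sub>R (\<Sum>i=1..k. T (Cs i)) \<in> N"
proof -
  \<comment> \<open>\<open>N\<close> is only affine, so the average is written as one of its points
    plus an average of displacements.\<close>
  have "(1 / real k) *\<^sub>R (\<Sum>i=1..k. T (Cs i))
      = T (Cs 1) + (1 / real k) *\<^sub>R (\<Sum>i=1..k. T (Cs i) - T (Cs 1))"
    using k by (simp add: sum_subtractf scaleR_diff_right sum_constant_scaleR)
  also have "\<dots> \<in> N"
    by (rule line_mem) (use k in \<open>auto intro!: subspace_sum cod.subspace cod.diff_mem T_in Cs\<close>)
  finally show ?thesis .
qed

text \<open>Steiner's identity: deviations from the mean \<open>m\<close> sum to zero, so the cross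
  terms vanish.\<close>

lemma sum_dist_square:
  fixes k :: nat
  assumes k: "k \<ge> 1" and Cs: "\<And>i. i \<in> {1..k} \<Longrightarrow> Cs i \<in> M" and q: "q \<in> M"
  defines "m \<equiv> (1 / real k) *\<^sub>R (\<Sum>i=1..k. T (Cs i))"
  shows "(\<Sum>i=1..k. (riem_dist M metric q (Cs i))\<^sup>2)
    = (\<Sum>i=1..k. ip (T (Cs i) - m) (T (Cs i) - m)) + real k * ip (m - T q) (m - T q)"
proof -
  obtain ip' where ip': "bounded_bilinear ip'" "\<And>x y. x \<in> U \<Longrightarrow> y \<in> U \<Longrightarrow> ip' x y = ip x y"
    using inner_product_on_extend[OF ip cod.subspace] by blast
  interpret bounded_bilinear ip' by fact
  have m: "m \<in> N"
    unfolding m_def by (rule mean_mem[OF k Cs])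
  define w where "w = m - T q"
  define z where "z = (\<lambda>i. T (Cs i) - m)"
  have w: "w \<in> U"
    unfolding w_def by (intro cod.diff_mem m T_in q)
  have z: "z i \<in> U" if "i \<in> {1..k}" for i
    unfolding z_def using that by (intro cod.diff_mem m T_in Cs)
  have sq: "(riem_dist M metric q (Cs i))\<^sup>2 = ip (z i) (z i) + 2 * ip' (z i) w + ip w w" if i: "i \<in> {1..k}" for i
  proof -
    have zw: "T (Cs i) - T q = z i + w"
      by (simp add: z_def w_def)
    have "z i + w \<in> U"
      using subspace_add[OF cod.subspace z[OF i] w] .
    then have "(riem_dist M metric q (Cs i))\<^sup>2 = ip' (z i + w) (z i + w)"
      using riem_dist_eq[OF q Cs[OF i]] inner_product_on_nonneg[OF ip cod.subspace, of "z i + w"]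
      by (simp add: zw ip'(2))
    also have "\<dots> = ip' (z i) (z i) + 2 * ip' (z i) w + ip' w w"
      using inner_product_onD(3)[OF ip w z[OF i]] by (simp add: add_left add_right ip'(2) w z[OF i])
    finally show ?thesis
      by (simp add: ip'(2) w z[OF i])
  qed
  have "(\<Sum>i=1..k. z i) = 0"
    using k by (simp add: z_def m_def sum_subtractf scaleR_right.sum[symmetric] flip: scaleR_scaleR)
      (simp add: sum_constant_scaleR)
  then have "(\<Sum>i=1..k. ip' (z i) w) = 0"
    using sum_left[of z "{1..k}" w] zero_left by simp
  then show ?thesis
    by (simp add: sq sum.distrib flip: sum_distrib_left z_def w_def) (simp add: z_def w_def)
qed

text \<open>Only the second summand of the decomposition depends on the candidate, and it vanishes
  exactly when the candidate is mapped to the mean.\<close>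

lemma is_frechet_mean_iff:
  assumes k: "k \<ge> 1" and Cs: "\<And>i. i \<in> {1..k} \<Longrightarrow> Cs i \<in> M"
  shows "is_frechet_mean M (riem_dist M metric) k Cs C \<longleftrightarrow>
    C = F ((1 / real k) *\<^sub>R (\<Sum>i=1..k. T (Cs i)))"
proof -
  define m where "m = (1 / real k) *\<^sub>R (\<Sum>i=1..k. T (Cs i))"
  have m: "m \<in> N"
    unfolding m_def by (rule mean_mem[OF k Cs])
  have sum_eq: "(\<Sum>i=1..k. (riem_dist M metric q (Cs i))\<^sup>2)
      = (\<Sum>i=1..k. ip (T (Cs i) - m) (T (Cs i) - m)) + real k * ip (m - T q) (m - T q)" if "q \<in> M" for q
    unfolding m_def by (rule sum_dist_square[OF k Cs that])
  have mU: "m - T q \<in> U" if "q \<in> M" for q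
    using that by (intro cod.diff_mem m T_in)
  have zero: "ip (m - T (F m)) (m - T (F m)) = 0"
    using inner_product_on_zero(1)[OF ip cod.subspace subspace_0[OF cod.subspace]] by (simp add: TF m)
  show ?thesis
    unfolding is_frechet_mean_def is_arg_min_def m_def[symmetric]
  proof
    assume L: "C \<in> M \<and> \<not> (\<exists>q. q \<in> M \<and>
      (\<Sum>i=1..k. (riem_dist M metric q (Cs i))\<^sup>2) < (\<Sum>i=1..k. (riem_dist M metric C (Cs i))\<^sup>2))"
    then have "\<not> real k * ip (m - T (F m)) (m - T (F m)) < real k * ip (m - T C) (m - T C)"
      using sum_eq[of C] sum_eq[of "F m"] F_in[OF m] by auto
    then have "ip (m - T C) (m - T C) \<le> 0"
      using k zero by (simp add: not_less mult_le_0_iff)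
    then have "m - T C = 0"
      using inner_product_onD(4)[OF ip mU mU] L by force
    then show "C = F m"
      using FT[of C] L by simp
  next
    assume C: "C = F m"
    have "(\<Sum>i=1..k. (riem_dist M metric C (Cs i))\<^sup>2) \<le> (\<Sum>i=1..k. (riem_dist M metric q (Cs i))\<^sup>2)"
      if "q \<in> M" for q
      unfolding C sum_eq[OF F_in[OF m]] sum_eq[OF that]
      using inner_product_on_nonneg[OF ip cod.subspace mU[OF that]] zero by simp
    then show "C \<in> M \<and> \<not> (\<exists>q. q \<in> M \<and>
      (\<Sum>i=1..k. (riem_dist M metric q (Cs i))\<^sup>2) < (\<Sum>i=1..k. (riem_dist M metric C (Cs i))\<^sup>2))"
      using F_in[OF m] by (auto simp: C not_less[symmetric])
  qed
qed

end

section \<open>Cholesky factorization\<close>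

text \<open>Triangular systems are solved index by index; counting predecessors provides strong
  induction on an index type that has an order but no arithmetic.\<close>

lemma finite_linorder_induct [case_names less]:
  fixes i :: "'n::{finite,linorder}"
  assumes "\<And>i. (\<And>j. j < i \<Longrightarrow> P j) \<Longrightarrow> P i"
  shows "P i"
proof (induction "card {j. j < i}" arbitrary: i rule: less_induct)
  case less
  show ?case
  proof (rule assms)
    fix j assume "j < i"
    then have "{k. k < j} \<subset> {k. k < i}"
      by (auto intro: less_trans)
    then show "P j"
      by (intro less) (simp add: psubset_card_mono)
  qed
qed

lemma matrix_inv_eqI:
  fixes A :: "'a::field^'n^'n"
  assumes "A ** B = mat 1"
  shows "matrix_inv A = B"
proof -
  have "\<exists>B. A ** B = mat 1 \<and> B ** A = mat 1"
    using assms matrix_left_right_inverse by blast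
  then have "A ** matrix_inv A = mat 1 \<and> matrix_inv A ** A = mat 1"
    unfolding matrix_inv_def by (rule someI_ex)
  then show ?thesis
    using assms by (metis matrix_mul_assoc matrix_mul_lid matrix_mul_rid)
qed

lemma matrix_mult_diagonal:
  fixes A :: "real^'n^'n::finite"
  shows "(A ** (\<chi> i j. if i = j then d i else 0)) $ i $ j = A $ i $ j * d j"
    and "((\<chi> i j. if i = j then d i else 0) ** A) $ i $ j = d i * A $ i $ j"
  by (simp_all add: matrix_matrix_mult_def if_distrib[of "\<lambda>x. _ * x"] if_distrib[of "\<lambda>x. x * _"] cong: if_cong)

lemma lower_triD: "lower_tri L \<Longrightarrow> i < j \<Longrightarrow> L $ i $ j = 0"
  by (simp add: lower_tri_def)

lemma lower_tri_mult_vec: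
  assumes "lower_tri L"
  shows "(L *v x) $ i = (\<Sum>k | k < i. L $ i $ k * x $ k) + L $ i $ i * x $ i"
proof -
  have "(L *v x) $ i = (\<Sum>k\<in>insert i {k. k < i}. L $ i $ k * x $ k)"
    unfolding matrix_vector_mult_def vec_lambda_beta
    by (intro sum.mono_neutral_right) (auto simp: neq_iff lower_triD[OF assms])
  then show ?thesis
    by (simp add: add.commute)
qed

lemma lower_tri_mult:
  assumes "lower_tri L"
  shows "(L ** B) $ i $ j = (\<Sum>k | k < i. L $ i $ k * B $ k $ j) + L $ i $ i * B $ i $ j"
  using lower_tri_mult_vec[OF assms, of "\<chi> k. B $ k $ j" i]
  by (simp add: matrix_vector_mult_def matrix_matrix_mult_def)

lemma lower_tri_mult_transpose:
  assumes "lower_tri K"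
  shows "(L ** transpose K) $ i $ j = (\<Sum>k | k < j. L $ i $ k * K $ j $ k) + L $ i $ j * K $ j $ j"
  using lower_tri_mult[OF assms, of "transpose L" j i]
  by (simp add: matrix_matrix_mult_def transpose_def mult.commute)

lemma lower_tri_mult_diag:
  assumes "lower_tri L" "lower_tri B"
  shows "(L ** B) $ i $ i = L $ i $ i * B $ i $ i"
  unfolding lower_tri_mult[OF assms(1)] by (simp add: lower_triD[OF assms(2)])

text \<open>Forward substitution: once the earlier coordinates vanish, row \<open>i\<close> reduces
  to its diagonal term.\<close>

lemma lower_tri_ker:
  assumes "lower_tri L" "\<And>i. L $ i $ i \<noteq> 0" "L *v x = 0"
  shows "x = 0"
proof -
  have "x $ i = 0" for i
  proof (induction i rule: finite_linorder_induct)
    case (less i)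
    have "0 = L $ i $ i * x $ i"
      using lower_tri_mult_vec[OF assms(1), of x i] less by (simp add: assms(3))
    then show ?case
      using assms(2) by simp
  qed
  then show ?thesis
    by (simp add: vec_eq_iff)
qed

lemma lower_tri_right_inverse:
  assumes "lower_tri L" "\<And>i. L $ i $ i \<noteq> 0"
  shows "L ** matrix_inv L = mat 1"
proof -
  obtain B where B: "B ** L = mat 1"
    using lower_tri_ker[OF assms] matrix_left_invertible_ker[of L] by blast
  then have "L ** B = mat 1"
    using matrix_left_right_inverse by blast
  then show ?thesis
    using matrix_inv_eqI by metis
qed

text \<open>Forward substitution in each column of \<open>B\<close>: above the diagonal the product
  is zero, and so are all earlier entries of the column.\<close>

lemma lower_tri_cancel:
  assumes "lower_tri L" "\<And>i. L $ i $ i \<noteq> 0" "lower_tri (L ** B)"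
  shows "lower_tri B"
  unfolding lower_tri_def
proof (intro allI impI)
  fix i j :: 'a
  assume "i < j"
  then show "B $ i $ j = 0"
  proof (induction i rule: finite_linorder_induct)
    case (less i)
    have "(\<Sum>k | k < i. L $ i $ k * B $ k $ j) = 0"
      using less by (intro sum.neutral) (auto dest: less_trans)
    moreover have "(L ** B) $ i $ j = 0"
      using less assms(3) by (intro lower_triD)
    ultimately show ?case
      using lower_tri_mult[OF assms(1), of B i j] assms(2) by simp
  qed
qed

text \<open>Equal earlier columns leave only the products with the diagonal entry. Positivity
  selects the root on the diagonal, and dividing by it settles the rest of the column.\<close>

lemma cholesky_factor_unique:
  assumes L: "lower_tri L" "\<And>i. L $ i $ i > 0" and K: "lower_tri K" "\<And>i. K $ i $ i > 0"
    and eq: "L ** transpose L = K ** transpose K"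
  shows "L = K"
proof -
  have "\<forall>i. L $ i $ j = K $ i $ j" for j
  proof (induction j rule: finite_linorder_induct)
    case (less j)
    have *: "L $ i $ j * L $ j $ j = K $ i $ j * K $ j $ j" for i
    proof -
      have "(\<Sum>k | k < j. L $ i $ k * L $ j $ k) = (\<Sum>k | k < j. K $ i $ k * K $ j $ k)"
        using less by (intro sum.cong) auto
      then show ?thesis
        using lower_tri_mult_transpose[OF L(1), of L i j] lower_tri_mult_transpose[OF K(1), of K i j]
        by (simp add: eq)
    qed
    have "(L $ j $ j)\<^sup>2 = (K $ j $ j)\<^sup>2"
      using *[of j] by (simp add: power2_eq_square)
    then have "L $ j $ j = K $ j $ j"
      using L(2)[of j] K(2)[of j] by (simp add: power2_eq_iff_nonneg)
    then show ?case
      using * L(2)[of j] by simp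
  qed
  then show ?thesis
    by (simp add: vec_eq_iff)
qed

text \<open>Row \<open>i\<close> of the inverse Cholesky factor, up to scaling: the basis vector \<open>e\<^sub>i\<close> made
  \<open>C\<close>-orthogonal to the earlier basis vectors.\<close>

lemma posdef_orthogonalized_axis:
  fixes C :: "('n::{finite,linorder}) sqmat"
  assumes pos: "\<And>x. x \<noteq> 0 \<Longrightarrow> x \<bullet> (C *v x) > 0"
  shows "\<exists>a. a $ i = 1 \<and> (\<forall>j>i. a $ j = 0) \<and> (\<forall>j<i. (C *v a) $ j = 0)"
proof -
  \<comment> \<open>The leading block of \<open>C\<close> on the indices below \<open>i\<close>,
    completed by an identity block to full size; positive definiteness makes it invertible.\<close>
  define B :: "'n sqmat" where "B = (\<chi> j k. if j < i then if k < i then C $ j $ k else 0 else if j = k then 1 else 0)"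
  have B_ge: "(B *v x) $ j = x $ j" if "\<not> j < i" for x j
    using that by (simp add: B_def matrix_vector_mult_def if_distrib[of "\<lambda>y. y * _"] cong: if_cong)
  have B_less: "(B *v x) $ j = (C *v x) $ j" if "j < i" and x: "\<And>k. \<not> k < i \<Longrightarrow> x $ k = 0" for x j
    using that by (auto simp: B_def matrix_vector_mult_def intro!: sum.cong)
  have "x = 0" if "B *v x = 0" for x
  proof (rule ccontr)
    have x: "x $ j = 0" if "\<not> j < i" for j
      using B_ge[OF that, of x] \<open>B *v x = 0\<close> by simp
    have "x $ j * (C *v x) $ j = 0" for j
      using x[of j] B_less[OF _ x, of j] \<open>B *v x = 0\<close> by (cases "j < i") auto
    then have "x \<bullet> (C *v x) = 0"
      unfolding inner_vec_def inner_real_def by (intro sum.neutral) simp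
    moreover assume "x \<noteq> 0"
    ultimately show False
      using pos by force
  qed
  then obtain B' where "B ** B' = mat 1"
    using matrix_left_invertible_ker[of B] matrix_left_right_inverse by blast
  \<comment> \<open>The right-hand side cancels column \<open>i\<close> of \<open>C\<close> in the
    rows before \<open>i\<close>.\<close>
  define x where "x = B' *v (\<chi> j. if j < i then - C $ j $ i else 0)"
  have Bx: "B *v x = (\<chi> j. if j < i then - C $ j $ i else 0)"
    unfolding x_def matrix_vector_mul_assoc \<open>B ** B' = mat 1\<close> by simp
  have x: "x $ j = 0" if "\<not> j < i" for j
    using B_ge[OF that, of x] that by (simp add: Bx)
  have "(C *v (axis i 1 + x)) $ j = 0" if "j < i" for j
    using B_less[OF that x] that
    by (simp add: Bx matrix_vector_right_distrib matrix_vector_mult_basis column_def)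
  moreover have "(axis i 1 + x) $ i = 1" "\<forall>j>i. (axis i 1 + x) $ j = 0"
    using x by (auto simp: axis_def)
  ultimately show ?thesis
    by blast
qed

lemma inner_matrix_symmetric:
  fixes C :: "('n::finite) sqmat"
  assumes "transpose C = C"
  shows "x \<bullet> (C *v y) = y \<bullet> (C *v x)"
  by (metis assms dot_lmul_matrix inner_commute vector_transpose_matrix)

text \<open>Gram-Schmidt for the form defined by \<open>C\<close>: the orthogonalized vectors are
  the rows of a matrix \<open>A\<close> that diagonalizes \<open>C\<close>, with diagonal
  \<open>D\<close>.\<close>

lemma cholesky_factor_exists:
  fixes C :: "('n::{finite,linorder}) sqmat"
  assumes sym: "transpose C = C" and pos: "\<And>x. x \<noteq> 0 \<Longrightarrow> x \<bullet> (C *v x) > 0"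
  shows "\<exists>L. lower_tri L \<and> (\<forall>i. L $ i $ i > 0) \<and> C = L ** transpose L"
proof -
  obtain a where a: "\<And>i. a i $ i = 1" "\<And>i j. i < j \<Longrightarrow> a i $ j = 0" "\<And>i j. j < i \<Longrightarrow> (C *v a i) $ j = 0"
    using posdef_orthogonalized_axis[OF pos] by metis
  define D where "D = (\<lambda>i. a i \<bullet> (C *v a i))"
  have D: "D i > 0" for i
    unfolding D_def using a(1)[of i] by (intro pos) auto
  have orth_less: "a i \<bullet> (C *v a j) = 0" if "i < j" for i j
  proof -
    have "a i $ k * (C *v a j) $ k = 0" for k
      using a(2)[of i k] a(3)[of k j] that by (cases "k < j") auto
    then show ?thesis
      unfolding inner_vec_def inner_real_def by (intro sum.neutral) simp
  qed
  then have orth: "a i \<bullet> (C *v a j) = (if i = j then D i else 0)" for i j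
    using inner_matrix_symmetric[OF sym, of "a i" "a j"] by (cases i j rule: linorder_cases) (auto simp: D_def)
  \<comment> \<open>Coordinates of \<open>C *v a j\<close> before \<open>j\<close> and coordinates
    of \<open>a j\<close> after \<open>j\<close> vanish, so a single product of the inner product is
    left.\<close>
  have diag: "(C *v a j) $ j = D j" for j
  proof -
    have "D j = (\<Sum>k\<in>UNIV. if k = j then (C *v a j) $ j else 0)"
      unfolding D_def inner_vec_def using a(1)[of j] a(2)[of j] a(3)[of _ j]
      by (intro sum.cong) (auto simp: neq_iff)
    then show ?thesis
      by simp
  qed
  define A :: "'n sqmat" where "A = (\<chi> i. a i)"
  \<comment> \<open>\<open>Q\<close> is the inverse of \<open>A\<close>, and \<open>L\<close> is
    \<open>Q\<close> with column \<open>j\<close> multiplied by \<open>sqrt (D j)\<close>.\<close>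
  define Q :: "'n sqmat" where "Q = (\<chi> i j. (C *v a j) $ i / D j)"
  define L :: "'n sqmat" where "L = (\<chi> i j. (C *v a j) $ i / sqrt (D j))"
  have "(A ** Q) $ i $ j = a i \<bullet> (C *v a j) / D j" for i j
    by (simp add: A_def Q_def matrix_matrix_mult_def inner_vec_def sum_divide_distrib)
  then have "A ** Q = mat 1"
    using D by (simp add: vec_eq_iff mat_def orth less_imp_neq[symmetric])
  then have QA: "Q ** A = mat 1"
    using matrix_left_right_inverse by blast
  have "(L ** transpose L) $ i $ j = ((Q ** A) ** C) $ i $ j" for i j
  proof -
    have AC: "(A ** C) $ k $ j = (C *v a k) $ j" for k
    proof -
      have "(A ** C) $ k $ j = (\<Sum>l\<in>UNIV. a k $ l * C $ l $ j)"
        by (simp add: A_def matrix_matrix_mult_def)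
      also have "\<dots> = (\<Sum>l\<in>UNIV. C $ j $ l * a k $ l)"
        using sym by (intro sum.cong) (auto simp: transpose_def vec_eq_iff mult.commute)
      finally show ?thesis
        by (simp add: matrix_vector_mult_def)
    qed
    have "(L ** transpose L) $ i $ j = (\<Sum>k\<in>UNIV. Q $ i $ k * (A ** C) $ k $ j)"
      unfolding AC using D
      by (auto simp: L_def Q_def matrix_matrix_mult_def transpose_def less_imp_le intro!: sum.cong)
    also have "\<dots> = (Q ** (A ** C)) $ i $ j"
      by (simp add: matrix_matrix_mult_def)
    finally show ?thesis
      by (simp add: matrix_mul_assoc)
  qed
  then have "C = L ** transpose L"
    by (simp add: QA vec_eq_iff)
  moreover have "lower_tri L"
    by (simp add: lower_tri_def L_def a(3))
  moreover have "L $ i $ i > 0" for i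
    using D[of i] by (simp add: L_def diag)
  ultimately show ?thesis
    by blast
qed

section \<open>Correlation matrices and unit lower triangular matrices\<close>

lemma cor_posD:
  assumes "C \<in> cor_pos"
  shows "transpose C = C" "x \<noteq> 0 \<Longrightarrow> x \<bullet> (C *v x) > 0" "C $ i $ i = 1"
  using assms unfolding cor_pos_def by auto

lemma chol_eqI:
  assumes "lower_tri L" "\<And>i. L $ i $ i > 0" "C = L ** transpose L"
  shows "chol C = L"
  unfolding chol_def using assms cholesky_factor_unique[OF _ _ assms(1,2)] by (intro the_equality) auto

lemma chol:
  assumes "C \<in> cor_pos"
  shows "lower_tri (chol C)" "chol C $ i $ i > 0" "C = chol C ** transpose (chol C)"
proof -
  obtain L where L: "lower_tri L" "\<And>i. L $ i $ i > 0" "C = L ** transpose L"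
    using cholesky_factor_exists[OF cor_posD(1,2)[OF assms]] by blast
  then have "chol C = L"
    by (rule chol_eqI)
  then show "lower_tri (chol C)" "chol C $ i $ i > 0" "C = chol C ** transpose (chol C)"
    using L by auto
qed

lemma chol_diag_neq_0: "C \<in> cor_pos \<Longrightarrow> chol C $ i $ i \<noteq> 0"
  using chol(2)[of C i] by simp

text \<open>This is the meaning of the unit diagonal of \<open>C\<close>. \<open>Theta\<close>
  rescales the rows by positive factors, and normalizing them undoes this.\<close>

lemma chol_row_norm:
  assumes "C \<in> cor_pos"
  shows "norm (chol C $ i) = 1"
proof -
  have "chol C $ i \<bullet> chol C $ i = (chol C ** transpose (chol C)) $ i $ i"
    by (simp add: inner_vec_def matrix_matrix_mult_def transpose_def)
  then show ?thesis
    using chol(3)[OF assms] cor_posD(3)[OF assms, of i] by (simp add: norm_eq_1)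
qed

lemma Theta_component:
  assumes "C \<in> cor_pos"
  shows "Theta C $ i $ j = chol C $ i $ j / chol C $ i $ i"
proof -
  let ?D = "\<chi> i j. if i = j then 1 / chol C $ i $ i else 0"
  have "diag_of (chol C) ** ?D = mat 1"
    using chol(2)[OF assms]
    by (simp add: vec_eq_iff matrix_mult_diagonal mat_def) (simp add: diag_of_def less_imp_neq[symmetric])
  then have "matrix_inv (diag_of (chol C)) = ?D"
    by (rule matrix_inv_eqI)
  then show ?thesis
    by (simp add: Theta_def matrix_mult_diagonal)
qed

definition LT1 :: "('n::{finite,linorder}) sqmat set" where
  "LT1 = {M. lower_tri M \<and> (\<forall>i. M $ i $ i = 1)}"

text \<open>The cosines of the angles between the rows of \<open>G\<close>: the matrix
  \<open>G ** transpose G\<close> scaled on both sides by the inverse root of its diagonal, written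
  entrywise.\<close>

definition cor_of :: "('n::finite) sqmat \<Rightarrow> 'n sqmat" where
  "cor_of G = (\<chi> i j. (G $ i \<bullet> G $ j) / (norm (G $ i) * norm (G $ j)))"

lemma LT1_row_neq_0: "G \<in> LT1 \<Longrightarrow> G $ i \<noteq> 0"
  unfolding LT1_def by (auto simp: vec_eq_iff intro!: exI[of _ i])

lemma Theta_LT1: "C \<in> cor_pos \<Longrightarrow> Theta C \<in> LT1"
  using chol[of C] by (auto simp: LT1_def lower_tri_def Theta_component less_imp_neq[symmetric])

lemma cor_of_factor:
  fixes G :: "('n::{finite,linorder}) sqmat"
  defines "L \<equiv> \<chi> i. (1 / norm (G $ i)) *\<^sub>R G $ i"
  shows "cor_of G = L ** transpose L"
  by (simp add: cor_of_def L_def vec_eq_iff matrix_matrix_mult_def transpose_def inner_vec_def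
      sum_divide_distrib mult.commute mult.left_commute)

lemma chol_cor_of:
  assumes "G \<in> LT1"
  shows "chol (cor_of G) = (\<chi> i. (1 / norm (G $ i)) *\<^sub>R G $ i)"
  by (rule chol_eqI[OF _ _ cor_of_factor])
    (use assms LT1_row_neq_0[OF assms] in \<open>auto simp: LT1_def lower_tri_def\<close>)

text \<open>A Gram matrix of linearly independent unit rows: \<open>L\<close> is invertible, so its
  transpose has trivial kernel.\<close>

lemma cor_of_cor_pos:
  assumes G: "G \<in> LT1"
  shows "cor_of G \<in> cor_pos"
proof -
  define L where "L = (\<chi> i. (1 / norm (G $ i)) *\<^sub>R G $ i)"
  have L: "lower_tri L" "L $ i $ i \<noteq> 0" for i
    using G LT1_row_neq_0[OF G] by (auto simp: LT1_def lower_tri_def L_def)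
  have C: "cor_of G = L ** transpose L"
    unfolding L_def by (rule cor_of_factor)
  have "x \<bullet> (cor_of G *v x) > 0" if "x \<noteq> 0" for x
  proof -
    have "x \<bullet> (cor_of G *v x) = (transpose L *v x) \<bullet> (transpose L *v x)"
      unfolding C matrix_vector_mul_assoc[symmetric]
      by (metis dot_lmul_matrix matrix_transpose_mul transpose_transpose vector_transpose_matrix)
    moreover have "transpose L *v x \<noteq> 0"
    proof
      assume "transpose L *v x = 0"
      have "matrix_inv L ** L = mat 1"
        using lower_tri_right_inverse[OF L] matrix_left_right_inverse by blast
      then have "x = (transpose (L ** matrix_inv L)) *v x"
        by (simp add: lower_tri_right_inverse[OF L] transpose_mat)
      also have "\<dots> = transpose (matrix_inv L) *v (transpose L *v x)"
        unfolding matrix_transpose_mul matrix_vector_mul_assoc ..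
      finally show False
        using that \<open>transpose L *v x = 0\<close> by simp
    qed
    ultimately show ?thesis
      by simp
  qed
  moreover have "transpose (cor_of G) = cor_of G"
    by (simp add: cor_of_def transpose_def inner_commute mult.commute vec_eq_iff)
  moreover have "cor_of G $ i $ i = 1" for i
    using LT1_row_neq_0[OF G, of i] by (simp add: cor_of_def dot_square_norm power2_eq_square)
  ultimately show ?thesis
    by (simp add: cor_pos_def)
qed

lemma Theta_cor_of:
  assumes G: "G \<in> LT1"
  shows "Theta (cor_of G) = G"
  using LT1_row_neq_0[OF G] G
  by (simp add: vec_eq_iff Theta_component[OF cor_of_cor_pos[OF G]] chol_cor_of[OF G] LT1_def)

lemma cor_of_Theta:
  assumes C: "C \<in> cor_pos"
  shows "cor_of (Theta C) = C"
proof -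
  have row: "Theta C $ i = (1 / chol C $ i $ i) *\<^sub>R chol C $ i" for i
    by (simp add: vec_eq_iff Theta_component[OF C])
  have "cor_of (Theta C) $ i $ j = chol C $ i \<bullet> chol C $ j" for i j
    using chol(2)[OF C, of i] chol(2)[OF C, of j] by (simp add: cor_of_def row chol_row_norm[OF C])
  then show ?thesis
    by (subst (2) chol(3)[OF C]) (simp add: vec_eq_iff inner_vec_def matrix_matrix_mult_def transpose_def)
qed

section \<open>The chart Theta\<close>

lemma subspace_hol: "subspace (hol :: ('n::finite) sqmat set)"
  by (auto simp: subspace_def hol_def transpose_def vec_eq_iff)

lemma subspace_LT0: "subspace (LT0 :: ('n::{finite,linorder}) sqmat set)"
  by (auto simp: subspace_def LT0_def lower_tri_def)

text \<open>The form has a positive minimum \<open>m\<close> on the compact unit sphere, where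
  \<open>X\<close> changes it by at most \<open>norm X * K\<close>; homogeneity covers all other
  nonzero vectors.\<close>

lemma posdef_perturb:
  fixes C :: "('n::finite) sqmat"
  assumes pos: "\<And>x. x \<noteq> 0 \<Longrightarrow> x \<bullet> (C *v x) > 0"
  shows "\<exists>e>0. \<forall>X. norm X < e \<longrightarrow> (\<forall>x. x \<noteq> 0 \<longrightarrow> x \<bullet> ((C + X) *v x) > 0)"
proof -
  have bl: "bilinear (\<lambda>(A :: 'n sqmat) x. A *v x)"
    unfolding bilinear_def
    by (auto intro!: linearI simp: matrix_vector_right_distrib matrix_vector_mult_add_rdistrib
        matrix_vector_mult_scaleR scaleR_matrix_vector_assoc)
  have "bounded_bilinear (\<lambda>(A :: 'n sqmat) x. A *v x)"
    using bl by (simp add: bilinear_conv_bounded_bilinear)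
  then obtain K where K: "K > 0" "\<And>(A :: 'n sqmat) x. norm (A *v x) \<le> norm A * norm x * K"
    using bounded_bilinear.pos_bounded by blast
  have ne: "sphere (0 :: real^'n) 1 \<noteq> {}"
    by simp
  have cont: "continuous_on (sphere 0 1) (\<lambda>x. x \<bullet> (C *v x))"
    by (intro continuous_intros linear_continuous_on matrix_vector_mul_bounded_linear)
  obtain z where z: "z \<in> sphere 0 1" "\<And>x. x \<in> sphere 0 1 \<Longrightarrow> z \<bullet> (C *v z) \<le> x \<bullet> (C *v x)"
    using continuous_attains_inf[OF compact_sphere ne cont] by blast
  define m where "m = z \<bullet> (C *v z)"
  have m: "m > 0"
    unfolding m_def using z(1) by (intro pos) auto
  have "x \<bullet> ((C + X) *v x) > 0" if X: "norm X < m / K" and x: "x \<noteq> 0" for X x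
  proof -
    define y where "y = x /\<^sub>R norm x"
    have y: "norm y = 1" and xy: "x = norm x *\<^sub>R y"
      using x by (simp_all add: y_def)
    have "\<bar>y \<bullet> (X *v y)\<bar> \<le> norm (X *v y)"
      using Cauchy_Schwarz_ineq2[of y "X *v y"] y by simp
    also have "\<dots> \<le> norm X * K"
      using K(2)[of X y] y by simp
    also have "\<dots> < m"
      using X K(1) by (simp add: pos_less_divide_eq)
    finally have "- m < y \<bullet> (X *v y)"
      by linarith
    moreover have "m \<le> y \<bullet> (C *v y)"
      unfolding m_def using y by (intro z(2)) simp
    ultimately have "y \<bullet> ((C + X) *v y) > 0"
      by (simp add: matrix_vector_mult_add_rdistrib inner_add_right)
    then show ?thesis
      using x by (subst (1 2) xy) (simp add: matrix_vector_mult_scaleR)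
  qed
  then show ?thesis
    using m K(1) by (intro exI[of _ "m / K"]) auto
qed

lemma open_in_affine_cor_pos: "open_in_affine (cor_pos :: ('n::finite) sqmat set) hol"
proof
  show "subspace (hol :: 'n sqmat set)"
    by (rule subspace_hol)
  fix p :: "'n sqmat" assume p: "p \<in> cor_pos"
  show "q - p \<in> hol" if "q \<in> cor_pos" for q
    using p that by (auto simp: cor_pos_def hol_def transpose_def vec_eq_iff)
  obtain e where e: "e > 0" "\<And>X x. norm X < e \<Longrightarrow> x \<noteq> 0 \<Longrightarrow> x \<bullet> ((p + X) *v x) > 0"
    using posdef_perturb[OF cor_posD(2)[OF p]] by blast
  show "\<exists>e>0. \<forall>X\<in>hol. norm X < e \<longrightarrow> p + X \<in> cor_pos"
    using e p by (intro exI[of _ e]) (auto simp: cor_pos_def hol_def transpose_def vec_eq_iff)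
qed

lemma open_in_affine_LT1: "open_in_affine (LT1 :: ('n::{finite,linorder}) sqmat set) LT0"
proof
  show "subspace (LT0 :: 'n sqmat set)"
    by (rule subspace_LT0)
  fix p :: "'n sqmat" assume p: "p \<in> LT1"
  show "q - p \<in> LT0" if "q \<in> LT1" for q
    using p that by (auto simp: LT1_def LT0_def lower_tri_def)
  show "\<exists>e>0. \<forall>X\<in>LT0. norm X < e \<longrightarrow> p + X \<in> LT1"
    using p by (intro exI[of _ 1]) (auto simp: LT1_def LT0_def lower_tri_def)
qed

section \<open>Smoothness of the chart and of its inverse\<close>

lemma chol_recursion:
  assumes "C \<in> cor_pos"
  shows "C $ i $ j = (\<Sum>k | k < j. chol C $ i $ k * chol C $ j $ k) + chol C $ i $ j * chol C $ j $ j"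
  by (subst (1) chol(3)[OF assms]) (rule lower_tri_mult_transpose[OF chol(1)[OF assms]])

text \<open>The Cholesky factor is smooth because it is computed from \<open>C\<close> by field operations and square
  roots, column by column.\<close>

lemma Ck_on_chol_component: "Ck_on (cor_pos :: ('n::{finite,linorder}) sqmat set) hol k (\<lambda>C. chol C $ i $ j)"
proof (induction j arbitrary: i rule: finite_linorder_induct)
  case (less j)
  interpret open_in_affine "cor_pos :: 'n sqmat set" hol
    by (rule open_in_affine_cor_pos)
  have rest: "Ck_on cor_pos hol k (\<lambda>C :: 'n sqmat. C $ i $ j - (\<Sum>l | l < j. chol C $ i $ l * chol C $ j $ l))" for i
    using less by (intro Ck_on_diff Ck_on_component[OF Ck_on_ident] Ck_on_sum) (auto intro: Ck_on_mult)
  have diag_sq: "C $ j $ j - (\<Sum>l | l < j. chol C $ j $ l * chol C $ j $ l) = (chol C $ j $ j)\<^sup>2"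
    if "C \<in> cor_pos" for C :: "'n sqmat"
    using chol_recursion[OF that, of j j] by (simp add: power2_eq_square)
  \<comment> \<open>On \<open>cor_pos\<close> the radicand is the square of a positive number, so
    the root is smooth there and returns the diagonal entry.\<close>
  have "Ck_on cor_pos hol k (\<lambda>C :: 'n sqmat. sqrt (C $ j $ j - (\<Sum>l | l < j. chol C $ j $ l * chol C $ j $ l)))"
  proof (rule Ck_on_sqrt[OF rest])
    show "0 < C $ j $ j - (\<Sum>l | l < j. chol C $ j $ l * chol C $ j $ l)" if "C \<in> cor_pos" for C :: "'n sqmat"
      unfolding diag_sq[OF that] using chol(2)[OF that, of j] by simp
  qed
  moreover have "sqrt (C $ j $ j - (\<Sum>l | l < j. chol C $ j $ l * chol C $ j $ l)) = chol C $ j $ j"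
    if "C \<in> cor_pos" for C :: "'n sqmat"
    unfolding diag_sq[OF that] using chol(2)[OF that, of j] by simp
  ultimately have diag: "Ck_on cor_pos hol k (\<lambda>C :: 'n sqmat. chol C $ j $ j)"
    by (rule iffD1[OF Ck_on_cong, rotated])
  have "Ck_on cor_pos hol k (\<lambda>C :: 'n sqmat.
      (C $ i $ j - (\<Sum>l | l < j. chol C $ i $ l * chol C $ j $ l)) * inverse (chol C $ j $ j))"
    by (intro Ck_on_mult[OF rest Ck_on_inverse[OF diag]] chol_diag_neq_0)
  moreover have "(C $ i $ j - (\<Sum>l | l < j. chol C $ i $ l * chol C $ j $ l)) * inverse (chol C $ j $ j)
      = chol C $ i $ j" if "C \<in> cor_pos" for C :: "'n sqmat"
    using chol(2)[OF that, of j] chol_recursion[OF that, of i j] by (simp add: field_simps)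
  ultimately show ?case
    by (rule iffD1[OF Ck_on_cong, rotated])
qed

lemma Ck_on_chol: "Ck_on (cor_pos :: ('n::{finite,linorder}) sqmat set) hol k chol"
  by (rule open_in_affine.Ck_on_matrix[OF open_in_affine_cor_pos Ck_on_chol_component])

lemma Ck_on_Theta: "Ck_on (cor_pos :: ('n::{finite,linorder}) sqmat set) hol k Theta"
proof -
  interpret open_in_affine "cor_pos :: 'n sqmat set" hol
    by (rule open_in_affine_cor_pos)
  show ?thesis
  proof (rule Ck_on_matrix)
    fix i j :: 'n
    have "Ck_on cor_pos hol k (\<lambda>C :: 'n sqmat. chol C $ i $ j * inverse (chol C $ i $ i))"
      by (intro Ck_on_mult Ck_on_inverse Ck_on_chol_component chol_diag_neq_0)
    then show "Ck_on cor_pos hol k (\<lambda>C :: 'n sqmat. Theta C $ i $ j)"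
      by (subst Ck_on_cong[where h = "\<lambda>C. chol C $ i $ j * inverse (chol C $ i $ i)"])
        (simp_all add: Theta_component divide_inverse)
  qed
qed

lemma Ck_on_cor_of: "Ck_on (LT1 :: ('n::{finite,linorder}) sqmat set) LT0 k cor_of"
proof -
  interpret open_in_affine "LT1 :: 'n sqmat set" LT0
    by (rule open_in_affine_LT1)
  show ?thesis
  proof (rule Ck_on_matrix)
    fix i j :: 'n
    have inner: "Ck_on LT1 LT0 k (\<lambda>G :: 'n sqmat. G $ i \<bullet> G $ j)" for i j
      unfolding inner_vec_def inner_real_def
      by (intro Ck_on_sum Ck_on_mult Ck_on_component Ck_on_ident)
    \<comment> \<open>The norm is smooth here because a row with diagonal entry 1 cannot
      vanish.\<close>
    have nrm: "Ck_on LT1 LT0 k (\<lambda>G :: 'n sqmat. norm (G $ i))" for i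
      unfolding norm_eq_sqrt_inner by (intro Ck_on_sqrt inner) (simp add: LT1_row_neq_0)
    have "Ck_on LT1 LT0 k (\<lambda>G :: 'n sqmat. (G $ i \<bullet> G $ j) * inverse (norm (G $ i) * norm (G $ j)))"
      by (intro Ck_on_mult Ck_on_inverse inner nrm) (simp add: LT1_row_neq_0)
    then show "Ck_on LT1 LT0 k (\<lambda>G :: 'n sqmat. cor_of G $ i $ j)"
      by (simp add: cor_of_def divide_inverse)
  qed
qed

lemma Theta_chart:
  fixes ip :: "('n::{finite,linorder}) sqmat \<Rightarrow> 'n sqmat \<Rightarrow> real"
  assumes "inner_product_on LT0 ip"
  shows "affine_chart cor_pos hol LT1 LT0 Theta cor_of ip"
proof -
  interpret dom: open_in_affine "cor_pos :: 'n sqmat set" hol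
    by (rule open_in_affine_cor_pos)
  interpret cod: open_in_affine "LT1 :: 'n sqmat set" LT0
    by (rule open_in_affine_LT1)
  show ?thesis
  proof
    show "y + u \<in> LT1" if "y \<in> LT1" "u \<in> LT0" for y u :: "'n sqmat"
      using that by (auto simp: LT1_def LT0_def lower_tri_def)
    show "smooth_fun_on (cor_pos :: 'n sqmat set) hol Theta" "smooth_fun_on (LT1 :: 'n sqmat set) LT0 cor_of"
      by (simp_all add: smooth_fun_on_def Ck_on_Theta Ck_on_cor_of)
  qed (use assms in \<open>simp_all add: Theta_LT1 cor_of_cor_pos cor_of_Theta Theta_cor_of\<close>)
qed

section \<open>The differential of the chart\<close>

lemma matrix_add_rdistrib: "(A + B) ** C = A ** C + B ** (C :: 'a::semiring_1^'n^'m)"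
  by (simp add: matrix_matrix_mult_def vec_eq_iff sum.distrib distrib_right)

text \<open>The diagonal of the sum is twice that of \<open>B\<close>, which is why
  \<open>lowS\<close> halves it.\<close>

lemma lowS_of_sum_transpose:
  assumes "lower_tri B"
  shows "lowS (B + transpose B) = B"
  using assms by (auto simp: lowS_def lower_tri_def transpose_def vec_eq_iff neq_iff)

lemma has_derivative_component:
  fixes f :: "'a::real_normed_vector \<Rightarrow> ('n::finite) sqmat"
  assumes "(f has_derivative f') F"
  shows "((\<lambda>p. f p $ i $ j) has_derivative (\<lambda>h. f' h $ i $ j)) F"
  by (rule bounded_linear.has_derivative[OF bounded_linear_compose[OF bounded_linear_vec_nth bounded_linear_vec_nth] assms])

text \<open>Differentiating \<open>L L\<^sup>T = C\<close> and multiplying by the inverse of \<open>L\<close> on both sides turns the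
  derivative \<open>K\<close> of the Cholesky factor into the lower triangular solution \<open>B = L\<^sup>-\<^sup>1 K\<close> of
  \<open>B + B\<^sup>T = L\<^sup>-\<^sup>1 X L\<^sup>-\<^sup>T\<close>.\<close>

lemma chol_has_derivative:
  fixes C :: "('n::{finite,linorder}) sqmat"
  assumes C: "C \<in> cor_pos" and X: "X \<in> hol"
    and K: "(chol has_derivative K) (at C within cor_pos)"
  shows "K X = chol C ** lowS (matrix_inv (chol C) ** X ** transpose (matrix_inv (chol C)))"
proof -
  interpret open_in_affine "cor_pos :: 'n sqmat set" hol
    by (rule open_in_affine_cor_pos)
  define L where "L = chol C"
  have L: "lower_tri L" "L $ i $ i \<noteq> 0" for i
    unfolding L_def using chol(1)[OF C] chol_diag_neq_0[OF C] by auto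
  have inv: "L ** matrix_inv L = mat 1" "matrix_inv L ** L = mat 1"
    using lower_tri_right_inverse[OF L] matrix_left_right_inverse by blast+
  \<comment> \<open>Entries above the diagonal vanish identically on \<open>cor_pos\<close>, hence
    so do their derivatives in tangent directions.\<close>
  have lowK: "lower_tri (K X)"
    unfolding lower_tri_def
  proof (intro allI impI)
    fix i j :: 'n assume "i < j"
    have "((\<lambda>C. chol C $ i $ j) has_derivative (\<lambda>X. 0)) (at C within cor_pos)"
      by (rule has_derivative_transform[OF C _ has_derivative_const[of 0]])
        (use \<open>i < j\<close> chol(1) in \<open>auto intro: lower_triD\<close>)
    then show "K X $ i $ j = 0"
      using has_derivative_unique_on[OF C X has_derivative_component[OF K]] by blast
  qed
  have X_eq: "X = L ** transpose (K X) + K X ** transpose L"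
  proof -
    have "X $ i $ j = (L ** transpose (K X) + K X ** transpose L) $ i $ j" for i j
    proof -
      have "((\<lambda>C. \<Sum>k\<in>UNIV. chol C $ i $ k * chol C $ j $ k) has_derivative
          (\<lambda>X. \<Sum>k\<in>UNIV. chol C $ i $ k * K X $ j $ k + K X $ i $ k * chol C $ j $ k)) (at C within cor_pos)"
        by (intro has_derivative_sum has_derivative_mult has_derivative_component K)
      then have "((\<lambda>C. C $ i $ j) has_derivative
          (\<lambda>X. \<Sum>k\<in>UNIV. chol C $ i $ k * K X $ j $ k + K X $ i $ k * chol C $ j $ k)) (at C within cor_pos)"
      proof (rule has_derivative_transform[OF C, rotated])
        show "D $ i $ j = (\<Sum>k\<in>UNIV. chol D $ i $ k * chol D $ j $ k)" if "D \<in> cor_pos" for D :: "'n sqmat"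
          by (subst chol(3)[OF that]) (simp add: matrix_matrix_mult_def transpose_def)
      qed
      from has_derivative_unique_on[OF C X has_derivative_component[OF has_derivative_ident] this]
      show ?thesis
        by (simp add: L_def matrix_matrix_mult_def transpose_def sum.distrib)
    qed
    then show ?thesis
      by (simp add: vec_eq_iff)
  qed
  define B where "B = matrix_inv L ** K X"
  have LB: "L ** B = K X"
    by (simp add: B_def matrix_mul_assoc inv)
  have "lower_tri B"
    using lower_tri_cancel[OF L, of B] lowK by (simp add: LB)
  have "matrix_inv L ** X ** transpose (matrix_inv L)
      = (matrix_inv L ** L) ** transpose (K X) ** transpose (matrix_inv L)
        + matrix_inv L ** K X ** transpose (matrix_inv L ** L)"
    by (subst X_eq) (simp only: matrix_add_ldistrib matrix_add_rdistrib matrix_mul_assoc matrix_transpose_mul)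
  also have "\<dots> = B + transpose B"
    by (simp add: inv transpose_mat B_def matrix_transpose_mul add.commute)
  finally show ?thesis
    using lowS_of_sum_transpose[OF \<open>lower_tri B\<close>] LB by (simp add: L_def)
qed

text \<open>The quotient rule for the entries of \<open>Theta\<close>. Because \<open>lowS\<close>
  halves the diagonal, the relative change of \<open>chol C $ i $ i\<close> is
  \<open>A $ i $ i / 2\<close>, which produces the subtracted term.\<close>

lemma dTheta_eq:
  fixes C :: "('n::{finite,linorder}) sqmat"
  assumes C: "C \<in> cor_pos" and X: "X \<in> hol"
  defines "A \<equiv> matrix_inv (chol C) ** X ** transpose (matrix_inv (chol C))"
  shows "dTheta C X = Theta C ** lowS A - (1/2) *\<^sub>R (diag_of A ** Theta C)"
proof -
  interpret open_in_affine "cor_pos :: 'n sqmat set" hol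
    by (rule open_in_affine_cor_pos)
  define K where "K = frechet_derivative chol (at C within cor_pos)"
  have K: "(chol has_derivative K) (at C within cor_pos)"
    unfolding K_def by (rule Ck_on_Suc_has_derivative[OF Ck_on_chol C])
  have KX: "K X = chol C ** lowS A"
    unfolding A_def by (rule chol_has_derivative[OF C X K])
  have "dTheta C X $ i $ j = (Theta C ** lowS A - (1/2) *\<^sub>R (diag_of A ** Theta C)) $ i $ j" for i j
  proof -
    note pos = chol_diag_neq_0[OF C, of i]
    have "((\<lambda>C. chol C $ i $ j / chol C $ i $ i) has_derivative
        (\<lambda>X. (K X $ i $ j * chol C $ i $ i - chol C $ i $ j * K X $ i $ i) / (chol C $ i $ i * chol C $ i $ i)))
        (at C within cor_pos)"
      by (rule has_derivative_divide'[OF has_derivative_component[OF K] has_derivative_component[OF K] pos])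
    then have "((\<lambda>C. Theta C $ i $ j) has_derivative
        (\<lambda>X. (K X $ i $ j * chol C $ i $ i - chol C $ i $ j * K X $ i $ i) / (chol C $ i $ i * chol C $ i $ i)))
        (at C within cor_pos)"
      by (rule has_derivative_transform[OF C Theta_component, rotated])
    moreover have "((\<lambda>C. Theta C $ i $ j) has_derivative (\<lambda>X. dTheta C X $ i $ j)) (at C within cor_pos)"
      unfolding dTheta_def by (rule has_derivative_component[OF Ck_on_Suc_has_derivative[OF Ck_on_Theta C]])
    ultimately have "dTheta C X $ i $ j
        = (K X $ i $ j * chol C $ i $ i - chol C $ i $ j * K X $ i $ i) / (chol C $ i $ i * chol C $ i $ i)"
      using has_derivative_unique_on[OF C X] by blast
    moreover have "K X $ i $ i = chol C $ i $ i * (A $ i $ i / 2)"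
      unfolding KX by (subst lower_tri_mult_diag[OF chol(1)[OF C]]) (auto simp: lowS_def lower_tri_def)
    moreover have "(Theta C ** lowS A) $ i $ j = K X $ i $ j / chol C $ i $ i"
      by (simp add: KX matrix_matrix_mult_def Theta_component[OF C] sum_divide_distrib)
    moreover have "diag_of A = (\<chi> i j. if i = j then A $ i $ i else 0)"
      by (simp add: diag_of_def vec_eq_iff)
    then have "(diag_of A ** Theta C) $ i $ j = A $ i $ i * (chol C $ i $ j / chol C $ i $ i)"
      by (simp add: matrix_mult_diagonal Theta_component[OF C])
    ultimately have "dTheta C X $ i $ j
        = (Theta C ** lowS A) $ i $ j - (1/2) * (diag_of A ** Theta C) $ i $ j"
      using pos by (simp add: diff_divide_distrib)
    then show ?thesis
      by simp
  qed
  then show ?thesis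
    by (simp add: vec_eq_iff)
qed

theorem theorem4p5:
  fixes ip :: "('n::{finite,linorder}) sqmat \<Rightarrow> 'n sqmat \<Rightarrow> real"
    and nrm :: "'n sqmat \<Rightarrow> real"
    and g :: "'n sqmat \<Rightarrow> 'n sqmat \<Rightarrow> 'n sqmat \<Rightarrow> real"
  assumes "inner_product_on LT0 ip"
    and "\<forall>X\<in>LT0. nrm X = sqrt (ip X X)"
    and "g = ec_metric ip"
  shows
    \<comment> \<open>the metric is indeed a Riemannian metric\<close>
    "riemannian_metric_on cor_pos hol g \<and>
     \<comment> \<open>differential of Theta\<close>
     (\<forall>C\<in>(cor_pos :: 'n sqmat set). (Theta has_derivative dTheta C) (at C within cor_pos) \<and>
        (\<forall>X\<in>hol. let L = chol C; A = matrix_inv L ** X ** transpose (matrix_inv L)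
           in dTheta C X = Theta C ** lowS A - (1/2) *\<^sub>R (diag_of A ** Theta C))) \<and>
     \<comment> \<open>exponential map\<close>
     (\<forall>C\<in>cor_pos. \<forall>X\<in>hol. \<forall>t.
        riem_exp cor_pos hol g C (t *\<^sub>R X) = Theta_inv (Theta C + t *\<^sub>R dTheta C X)) \<and>
     \<comment> \<open>logarithm map\<close>
     (\<forall>C\<in>cor_pos. \<forall>C'\<in>cor_pos.
        riem_log cor_pos hol g C C' = dTheta_inv C (Theta C' - Theta C)) \<and>
     \<comment> \<open>the geodesic from C at time 0 to C' at time 1, on any interval containing 0 and 1\<close>
     (\<forall>C\<in>cor_pos. \<forall>C'\<in>cor_pos. \<forall>I \<gamma>. is_interval I \<and> 0 \<in> I \<and> 1 \<in> I \<longrightarrow>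
        (geodesic_on cor_pos hol g I \<gamma> \<and> \<gamma> 0 = C \<and> \<gamma> 1 = C' \<longleftrightarrow>
         (\<forall>t\<in>I. \<gamma> t = Theta_inv ((1 - t) *\<^sub>R Theta C + t *\<^sub>R Theta C')))) \<and>
     \<comment> \<open>distance\<close>
     (\<forall>C\<in>cor_pos. \<forall>C'\<in>cor_pos. riem_dist cor_pos g C C' = nrm (Theta C' - Theta C)) \<and>
     \<comment> \<open>parallel transport\<close>
     (\<forall>C\<in>cor_pos. \<forall>C'\<in>cor_pos. \<forall>X\<in>hol.
        riem_transport cor_pos hol g C C' X = dTheta_inv C' (dTheta C X)) \<and>
     \<comment> \<open>curvature\<close>
     (\<forall>C\<in>cor_pos. \<forall>X\<in>hol. \<forall>Y\<in>hol. \<forall>Z\<in>hol. riem_curvature cor_pos hol g C X Y Z = 0) \<and>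
     \<comment> \<open>Frechet mean\<close>
     (\<forall>k\<ge>1. \<forall>Cs. (\<forall>i\<in>{1..k}. Cs i \<in> cor_pos) \<longrightarrow>
        (\<forall>C. is_frechet_mean cor_pos (riem_dist cor_pos g) k Cs C \<longleftrightarrow>
             C = Theta_inv ((1 / real k) *\<^sub>R (\<Sum>i=1..k. Theta (Cs i))))) \<and>
     \<comment> \<open>geodesic completeness\<close>
     geodesically_complete cor_pos hol g"
proof -
  interpret affine_chart cor_pos hol LT1 LT0 Theta cor_of ip
    by (rule Theta_chart[OF assms(1)])
  have dT_eq: "dT = (dTheta :: 'n sqmat \<Rightarrow> _)"
    by (simp add: fun_eq_iff dT_def dTheta_def)
  have g: "g = metric"
    by (simp add: fun_eq_iff assms(3) ec_metric_def metric_def dT_eq)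
  \<comment> \<open>\<open>inv_into\<close> is meaningful only on the image of \<open>Theta\<close>,
    so each argument of \<open>Theta_inv\<close> has to be shown to lie in
    \<open>LT1\<close>.\<close>
  have Theta_inv: "Theta_inv y = cor_of y" if "y \<in> LT1" for y :: "'n sqmat"
    unfolding Theta_inv_def by (rule inv_into_T[OF that])
  have dTheta_inv: "dTheta_inv C u = dF (Theta C) u" if "C \<in> cor_pos" "u \<in> LT0" for C u :: "'n sqmat"
    unfolding dTheta_inv_def using inv_into_dT[OF that] by (simp add: dT_eq)
  \<comment> \<open>As a point plus a multiple of a direction, the combination stays in
    \<open>LT1\<close> for every real \<open>t\<close>, not just between 0 and 1.\<close>
  have line: "(1 - t) *\<^sub>R Theta C + t *\<^sub>R Theta C' = Theta C + t *\<^sub>R (Theta C' - Theta C)"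
    for C C' :: "'n sqmat" and t
    by (simp add: algebra_simps)
  have line_in: "(1 - t) *\<^sub>R Theta C + t *\<^sub>R Theta C' \<in> LT1" if "C \<in> cor_pos" "C' \<in> cor_pos"
    for C C' :: "'n sqmat" and t
    unfolding line using that by (intro line_mem cod.diff_mem T_in)
  have exp: "riem_exp cor_pos hol g C (t *\<^sub>R X) = Theta_inv (Theta C + t *\<^sub>R dTheta C X)"
    if C: "C \<in> cor_pos" and X: "X \<in> hol" for C X :: "'n sqmat" and t
  proof -
    \<comment> \<open>\<open>riem_exp\<close> looks at time 1, so a general \<open>t\<close> enters
      through the homogeneity of \<open>dT C\<close>.\<close>
    have "dT C (t *\<^sub>R X) = t *\<^sub>R dT C X"
      using bounded_linear.linear[OF bounded_linear_dT[OF C]] by (rule linear_scale)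
    then show ?thesis
      using riem_exp_eq[OF C subspace_scale[OF subspace_hol X]] Theta_inv[OF line_mem[OF T_in[OF C] dT_mem[OF C X]]]
      by (simp add: g dT_eq)
  qed
  have frechet: "is_frechet_mean cor_pos (riem_dist cor_pos g) k Cs C \<longleftrightarrow>
      C = Theta_inv ((1 / real k) *\<^sub>R (\<Sum>i=1..k. Theta (Cs i)))"
    if "k \<ge> 1" "\<forall>i\<in>{1..k}. Cs i \<in> cor_pos" for k Cs and C :: "'n sqmat"
    using is_frechet_mean_iff[of k Cs C] mean_mem[of k Cs] Theta_inv that by (simp add: g)
  show ?thesis
  proof (intro conjI ballI allI impI)
    show "riemannian_metric_on cor_pos hol g" "geodesically_complete cor_pos hol g"
      unfolding g by (rule riemannian_metric, rule geodesically_complete_metric)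
    fix C C' :: "'n sqmat" assume C: "C \<in> cor_pos" and C': "C' \<in> cor_pos"
    have u: "Theta C' - Theta C \<in> LT0"
      by (intro cod.diff_mem T_in C C')
    show "riem_log cor_pos hol g C C' = dTheta_inv C (Theta C' - Theta C)"
      by (simp add: g riem_log_eq C C' dTheta_inv u)
    show "riem_dist cor_pos g C C' = nrm (Theta C' - Theta C)"
      using assms(2) u by (simp add: g riem_dist_eq C C')
    show "riem_transport cor_pos hol g C C' X = dTheta_inv C' (dTheta C X)" if "X \<in> hol" for X
      using dT_mem[OF C that] by (simp add: g riem_transport_eq C C' that dTheta_inv dT_eq)
    show "geodesic_on cor_pos hol g I \<gamma> \<and> \<gamma> 0 = C \<and> \<gamma> 1 = C' \<longleftrightarrow>
         (\<forall>t\<in>I. \<gamma> t = Theta_inv ((1 - t) *\<^sub>R Theta C + t *\<^sub>R Theta C'))"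
      if "is_interval I \<and> 0 \<in> I \<and> 1 \<in> I" for I \<gamma>
      using geodesic_iff_line[of I C C' \<gamma>] that by (simp add: g C C' Theta_inv line_in)
  next
    fix C :: "'n sqmat" assume C: "C \<in> cor_pos"
    show "(Theta has_derivative dTheta C) (at C within cor_pos)"
      using dT[OF C] by (simp add: dT_eq)
    fix X :: "'n sqmat" assume X: "X \<in> hol"
    show "let L = chol C; A = matrix_inv L ** X ** transpose (matrix_inv L)
        in dTheta C X = Theta C ** lowS A - (1/2) *\<^sub>R (diag_of A ** Theta C)"
      unfolding Let_def by (rule dTheta_eq[OF C X])
    show "riem_exp cor_pos hol g C (t *\<^sub>R X) = Theta_inv (Theta C + t *\<^sub>R dTheta C X)" for t
      by (rule exp[OF C X])
    show "riem_curvature cor_pos hol g C X Y Z = 0" if "Y \<in> hol" "Z \<in> hol" for Y Z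
      unfolding g by (rule riem_curvature_eq_0[OF C X that])
  qed (rule frechet)
qed

end
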